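(* Let $A\in\mathbb{R}^{m\times n}$ and $b\in\mathbb{R}^m$ be such that $Ax=b$ is consistent. Let $f:\mathbb{R}^n\to\mathbb{R}$ be $\gamma$-strongly convex ($\gamma>0$) and strongly admissible, and let $\widehat{x}$ be the solution of $\min_x f(x)$ subject to $Ax=b$. Suppose that the probability spaces $\{(\Omega_k,\mathcal{F}_k,P_k)\}_{k\ge 1}$ of sampling matrices are such that $\mathbb{E}_{S\in\Omega_k}[SS^\top]$ is positive definite for every $k\ge 1$. Let $\{x^k\}_{k\ge1}$ and $\{z^k\}_{k\ge1}$ be the sequences generated by the ASDCD algorithm (described in the context). Then for every $k\ge1$ $$\mathbb{E}_k\left[D_{f,z^{k+1}}(x^{k+1},\widehat{x})\right]\le\left(1-\frac{\gamma\nu\lambda_{\min}(H_k)}{2\lambda_{\max}^{(k)}}\right)D_{f,z^k}(x^k,\widehat{x})-\frac{\gamma}{2}\,\mathbb{E}_k\left[\cos^2\theta_k\,\|y^{k+1}-\widehat{x}\|_2^2\right],$$ where $\nu$, $H_k$, $\lambda_{\max}^{(k)}$, $y^{k+1}$, $\theta_k$ are defined in the context.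
   Context: **Convexity notions.** A convex $f:\mathbb{R}^n\to\mathbb{R}$ is $\gamma$-strongly convex if $f(y)\ge f(x)+\langle z,y-x\rangle+\frac{\gamma}{2}\|y-x\|_2^2$ for all $x,y\in\mathbb{R}^n$, $z\in\partial f(x)$. Its conjugate is $f^*(y)=\sup_x\{\langle y,x\rangle-f(x)\}$ (which is then differentiable with $\frac1\gamma$-Lipschitz gradient). For $z\in\partial f(x)$, the Bregman distance is $D_{f,z}(x,y)=f(y)-f(x)-\langle z,y-x\rangle$. A convex differentiable function $g$ on $\mathbb{R}^m$ with nonempty minimizer set $X_g$ is restricted strongly convex if there is $\mu>0$ such that for all $y$, $\langle\nabla g(\mathrm{Proj}_{X_g}(y))-\nabla g(y),\mathrm{Proj}_{X_g}(y)-y\rangle\ge\mu\|\mathrm{Proj}_{X_g}(y)-y\|_2^2$, where $\mathrm{Proj}_{X_g}$ is the orthogonal projection onto $X_g$. A strongly convex $f$ is strongly admissible if $g(y)=f^*(A^\top y)-\langle b,y\rangle$ is restricted strongly convex on $\mathbb{R}^m$ for all $A\in\mathbb{R}^{m\times n}$ and all $b\in\mathrm{Range}(A)$. **The constant $\nu$.** If $f$ is strongly admissible, it is known that there exists $\nu>0$ with $D_{f,z}(x,\widehat{x})\le\frac1\nu\|A(x-\widehat{x})\|_2^2$ for all $x\in\mathbb{R}^n$ and all $z\in\partial f(x)\cap\mathrm{Range}(A^\top)$. $\nu$ denotes such a constant. **ASDCD algorithm.** The convention $\frac00=0$ is used. Each $\Omega_k$ is a set of real matrices with $m$ rows. Given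 $\xi^0\in\mathbb{R}^m$, $z^0\in\mathrm{Range}(A^\top)$, set $z^1=z^0+A^\top\xi^0$, $\rho_1=\langle\xi^0,b\rangle$, $x^0=\nabla f^*(z^0)$, $x^1=\nabla f^*(z^1)$. For $k=1,2,\dots$: draw $S_k\in\Omega_k$ according to $P_k$, independently of $S_1,\dots,S_{k-1}$; set $d^k=A^\top S_kS_k^\top(Ax^k-b)$, $\Delta^k=z^k-z^{k-1}$ and $$L_{\mathrm{adap}}^{k,\gamma}=\frac{\gamma\|S_k^\top(Ax^k-b)\|_2^2}{\|d^k\|_2^2}.$$ If $\|d^k\|_2^2\|\Delta^k\|_2^2-\langle d^k,\Delta^k\rangle^2=0$, set $\beta_k=0$ and $\alpha_k=L_{\mathrm{adap}}^{k,\gamma}$ if $S_k^\top(Ax^k-b)\ne0$, $\alpha_k=0$ otherwise. Else set $$\alpha_k=\gamma\frac{\|S_k^\top(Ax^k-b)\|_2^2\|\Delta^k\|_2^2-\langle d^k,\Delta^k\rangle(\langle\Delta^k,x^k\rangle-\rho_k)}{\|d^k\|_2^2\|\Delta^k\|_2^2-\langle d^k,\Delta^k\rangle^2},\quad \beta_k=\gamma\frac{-\|d^k\|_2^2(\langle\Delta^k,x^k\rangle-\rho_k)+\langle d^k,\Delta^k\rangle\|S_k^\top(Ax^k-b)\|_2^2}{\|d^k\|_2^2\|\Delta^k\|_2^2-\langle d^k,\Delta^k\rangle^2}.$$ Then set $z^{k+1}=z^k-\alpha_kd^k+\beta_k(z^k-z^{k-1})$, $\rho_{k+1}=-\alpha_k\langle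 S_kS_k^\top(Ax^k-b),b\rangle+\beta_k\rho_k$, $x^{k+1}=\nabla f^*(z^{k+1})$. **Notation.** $\mathbb{E}_k[\cdot]=\mathbb{E}[\cdot\mid S_1,\dots,S_{k-1}]$. Further, $$y^{k+1}=x^k-\frac{L_{\mathrm{adap}}^{k,\gamma}}{\gamma}d^k,\quad u^k=\langle d^k,z^k-z^{k-1}\rangle d^k-\|d^k\|_2^2(z^k-z^{k-1}),\quad \theta_k=\arccos\frac{\langle y^{k+1}-\widehat{x},u^k\rangle}{\|y^{k+1}-\widehat{x}\|_2\|u^k\|_2},$$ $$H_k=\begin{cases}\mathbb{E}_{S\in\Omega_k}[SS^\top]&\text{if }\Omega_k\text{ is bounded},\\ \mathbb{E}_{S\in\Omega_k}\left[\frac{SS^\top}{\|S\|_2^2}\right]&\text{otherwise},\end{cases}\qquad \lambda_{\max}^{(k)}=\begin{cases}\sup_{S\in\Omega_k}\lambda_{\max}(A^\top SS^\top A)&\text{if }\Omega_k\text{ is bounded},\\ \sup_{S\in\Omega_k}\lambda_{\max}\left(\frac{A^\top SS^\top A}{\|S\|_2^2}\right)&\text{otherwise}.\end{cases}$$ $\|S\|_2$ is the spectral norm; $\lambda_{\min},\lambda_{\max}$ denote smallest and largest eigenvalues. *)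

theory Defs
  imports "HOL-Analysis.Analysis" "HOL-Probability.Probability"
begin

section \<open>Convex analysis\<close>

definition subdifferential :: "('a::real_inner \<Rightarrow> real) \<Rightarrow> 'a \<Rightarrow> 'a set" where
  "subdifferential f x = {z. \<forall>y. f y \<ge> f x + z \<bullet> (y - x)}"

definition strongly_convex :: "real \<Rightarrow> ('a::real_inner \<Rightarrow> real) \<Rightarrow> bool" where
  "strongly_convex \<gamma> f \<longleftrightarrow> convex_on UNIV f \<and>
     (\<forall>x y. \<forall>z\<in>subdifferential f x.
        f y \<ge> f x + z \<bullet> (y - x) + \<gamma> / 2 * (norm (y - x))\<^sup>2)"

(* The supremum is taken in the reals.  It is used only for strongly convex f on a
   Euclidean space, for which the set is bounded above. *)
definition conjugate :: "('a::real_inner \<Rightarrow> real) \<Rightarrow> 'a \<Rightarrow> real" where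
  "conjugate f y = (SUP x. y \<bullet> x - f x)"

(* Meaningful only where g is differentiable. *)
definition gradient :: "('a::real_inner \<Rightarrow> real) \<Rightarrow> 'a \<Rightarrow> 'a" where
  "gradient g x = (THE D. GDERIV g x :> D)"

definition bregman :: "('a::real_inner \<Rightarrow> real) \<Rightarrow> 'a \<Rightarrow> 'a \<Rightarrow> 'a \<Rightarrow> real" where
  "bregman f z x y = f y - f x - z \<bullet> (y - x)"

definition minimizers :: "('a \<Rightarrow> real) \<Rightarrow> 'a set" where
  "minimizers g = {x. is_arg_min g (\<lambda>_. True) x}"

(* closest_point is the orthogonal projection: the set of minimizers is closed and convex
   for g as required here. *)
definition restricted_strongly_convex :: "('a::euclidean_space \<Rightarrow> real) \<Rightarrow> bool" where
  "restricted_strongly_convex g \<longleftrightarrow>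
     convex_on UNIV g \<and> g differentiable_on UNIV \<and> minimizers g \<noteq> {} \<and>
     (\<exists>\<mu>>0. \<forall>y. let p = closest_point (minimizers g) y in
        (gradient g p - gradient g y) \<bullet> (p - y) \<ge> \<mu> * (norm (p - y))\<^sup>2)"

(* The type argument fixes the number m of rows of the matrices A quantified over. *)
definition strongly_admissible :: "'m::finite itself \<Rightarrow> (real^'n \<Rightarrow> real) \<Rightarrow> bool" where
  "strongly_admissible TYPE('m) f \<longleftrightarrow>
     (\<exists>\<gamma>>0. strongly_convex \<gamma> f) \<and>
     (\<forall>A :: real^'n^'m. \<forall>b \<in> range (\<lambda>x. A *v x).
        restricted_strongly_convex (\<lambda>y. conjugate f (transpose A *v y) - b \<bullet> y))"


section \<open>Matrices\<close>

definition is_eigenvalue :: "real^'n^'n \<Rightarrow> real \<Rightarrow> bool" where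
  "is_eigenvalue H c \<longleftrightarrow> (\<exists>v. v \<noteq> 0 \<and> H *v v = c *\<^sub>R v)"

(* Used for symmetric matrices only, so real eigenvalues suffice and always exist. *)
definition lambda_min :: "real^'n^'n \<Rightarrow> real" where
  "lambda_min H = (LEAST c. is_eigenvalue H c)"

definition lambda_max :: "real^'n^'n \<Rightarrow> real" where
  "lambda_max H = (GREATEST c. is_eigenvalue H c)"

(* In particular, a Bochner integral that is positive definite is the integral of an
   integrable function, since the integral of a non-integrable function is 0. *)
definition positive_definite :: "real^'n^'n \<Rightarrow> bool" where
  "positive_definite H \<longleftrightarrow> transpose H = H \<and> (\<forall>v. v \<noteq> 0 \<longrightarrow> v \<bullet> (H *v v) > 0)"


section \<open>Sampling matrices\<close>

(* A sampling matrix has m rows and an arbitrary finite number of columns, which may differ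
   between samples.  It is represented as the list of its columns; vectors indexed by the
   columns are real lists. *)
type_synonym 'm sampling_matrix = "(real^'m) list"

definition list_norm :: "real list \<Rightarrow> real" where
  "list_norm w = sqrt (\<Sum>t\<leftarrow>w. t\<^sup>2)"

definition mult_vec :: "'m::finite sampling_matrix \<Rightarrow> real list \<Rightarrow> real^'m" where
  "mult_vec S w = (\<Sum>j<length S. w ! j *\<^sub>R S ! j)"

definition transpose_mult_vec :: "'m::finite sampling_matrix \<Rightarrow> real^'m \<Rightarrow> real list" where
  "transpose_mult_vec S v = map (\<lambda>c. c \<bullet> v) S"

(* The m x m matrix S S^T. *)
definition gram :: "'m::finite sampling_matrix \<Rightarrow> real^'m^'m" where
  "gram S = (\<chi> i j. \<Sum>c\<leftarrow>S. c $ i * c $ j)"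

definition spectral_norm :: "'m::finite sampling_matrix \<Rightarrow> real" where
  "spectral_norm S = Sup {norm (mult_vec S w) | w. length w = length S \<and> list_norm w \<le> 1}"

definition bounded_samples :: "'m::finite sampling_matrix set \<Rightarrow> bool" where
  "bounded_samples \<Omega> \<longleftrightarrow> (\<exists>C. \<forall>S\<in>\<Omega>. spectral_norm S \<le> C)"

(* A probability space (Omega, F, P) is given as a single measure whose space is Omega. *)
definition sample_mean :: "'m::finite sampling_matrix measure \<Rightarrow> real^'m^'m" where
  "sample_mean P =
     (if bounded_samples (space P) then \<integral>S. gram S \<partial>P
      else \<integral>S. (1 / (spectral_norm S)\<^sup>2) *\<^sub>R gram S \<partial>P)"

definition sample_lambda_max ::
  "real^'n^'m \<Rightarrow> 'm::finite sampling_matrix measure \<Rightarrow> real" where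
  "sample_lambda_max A P =
     (if bounded_samples (space P)
      then SUP S\<in>space P. lambda_max (transpose A ** gram S ** A)
      else SUP S\<in>space P.
        lambda_max ((1 / (spectral_norm S)\<^sup>2) *\<^sub>R (transpose A ** gram S ** A)))"


section \<open>The ASDCD algorithm\<close>

(* Division by zero in HOL yields 0, in accordance with the convention 0/0 = 0. *)

context
  fixes \<gamma> :: real and A :: "real^'n^'m" and b :: "real^'m"
begin

(* The squared norm of S^T (A x - b). *)
definition sketched_res_sq :: "'m sampling_matrix \<Rightarrow> real^'n \<Rightarrow> real" where
  "sketched_res_sq S x = (list_norm (transpose_mult_vec S (A *v x - b)))\<^sup>2"

definition direction :: "'m sampling_matrix \<Rightarrow> real^'n \<Rightarrow> real^'n" where
  "direction S x = transpose A *v (gram S *v (A *v x - b))"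

definition L_adap :: "'m sampling_matrix \<Rightarrow> real^'n \<Rightarrow> real" where
  "L_adap S x = \<gamma> * sketched_res_sq S x / (norm (direction S x))\<^sup>2"

definition step_det :: "'m sampling_matrix \<Rightarrow> real^'n \<Rightarrow> real^'n \<Rightarrow> real" where
  "step_det S x \<Delta> =
     (norm (direction S x))\<^sup>2 * (norm \<Delta>)\<^sup>2 - (direction S x \<bullet> \<Delta>)\<^sup>2"

definition step_alpha :: "'m sampling_matrix \<Rightarrow> real^'n \<Rightarrow> real^'n \<Rightarrow> real \<Rightarrow> real" where
  "step_alpha S x \<Delta> \<rho> =
     (if step_det S x \<Delta> = 0
      then (if (\<exists>t\<in>set (transpose_mult_vec S (A *v x - b)). t \<noteq> 0) then L_adap S x else 0)
      else \<gamma> * ((sketched_res_sq S x * (norm \<Delta>)\<^sup>2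
                   - (direction S x \<bullet> \<Delta>) * (\<Delta> \<bullet> x - \<rho>)) / step_det S x \<Delta>))"

definition step_beta :: "'m sampling_matrix \<Rightarrow> real^'n \<Rightarrow> real^'n \<Rightarrow> real \<Rightarrow> real" where
  "step_beta S x \<Delta> \<rho> =
     (if step_det S x \<Delta> = 0 then 0
      else \<gamma> * ((- (norm (direction S x))\<^sup>2 * (\<Delta> \<bullet> x - \<rho>)
                   + (direction S x \<bullet> \<Delta>) * sketched_res_sq S x) / step_det S x \<Delta>))"

(* The sequences generated from xi0, z0 and the sampling matrices S 1, S 2, ...;
   S 0 and rho 0 play no role. *)
definition asdcd_sequences ::
  "(real^'n \<Rightarrow> real) \<Rightarrow> real^'m \<Rightarrow> real^'n \<Rightarrow> (nat \<Rightarrow> 'm sampling_matrix) \<Rightarrow>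
   (nat \<Rightarrow> real^'n) \<Rightarrow> (nat \<Rightarrow> real^'n) \<Rightarrow> (nat \<Rightarrow> real) \<Rightarrow> bool" where
  "asdcd_sequences f \<xi>0 z0 S x z \<rho> \<longleftrightarrow>
     z 0 = z0 \<and> z 1 = z0 + transpose A *v \<xi>0 \<and> \<rho> 1 = \<xi>0 \<bullet> b \<and>
     (\<forall>k. x k = gradient (conjugate f) (z k)) \<and>
     (\<forall>k\<ge>1. let \<Delta> = z k - z (k - 1);
                \<alpha> = step_alpha (S k) (x k) \<Delta> (\<rho> k);
                \<beta> = step_beta (S k) (x k) \<Delta> (\<rho> k)
            in z (k + 1) = z k - \<alpha> *\<^sub>R direction (S k) (x k) + \<beta> *\<^sub>R \<Delta> \<and>
               \<rho> (k + 1) = - \<alpha> * ((gram (S k) *v (A *v x k - b)) \<bullet> b) + \<beta> * \<rho> k)"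

definition y_next :: "'m sampling_matrix \<Rightarrow> real^'n \<Rightarrow> real^'n" where
  "y_next S x = x - (L_adap S x / \<gamma>) *\<^sub>R direction S x"

definition u_vec :: "'m sampling_matrix \<Rightarrow> real^'n \<Rightarrow> real^'n \<Rightarrow> real^'n" where
  "u_vec S x \<Delta> =
     (direction S x \<bullet> \<Delta>) *\<^sub>R direction S x - (norm (direction S x))\<^sup>2 *\<^sub>R \<Delta>"

definition angle_theta :: "real^'n \<Rightarrow> 'm sampling_matrix \<Rightarrow> real^'n \<Rightarrow> real^'n \<Rightarrow> real" where
  "angle_theta xhat S x \<Delta> =
     arccos (((y_next S x - xhat) \<bullet> u_vec S x \<Delta>)
             / (norm (y_next S x - xhat) * norm (u_vec S x \<Delta>)))"

end

(* The sigma-algebra generated by S 1, ..., S (k - 1), so that conditional expectation with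
   respect to it is the expectation E_k. *)
definition past ::
  "'w measure \<Rightarrow> (nat \<Rightarrow> 's measure) \<Rightarrow> (nat \<Rightarrow> 'w \<Rightarrow> 's) \<Rightarrow> nat \<Rightarrow> 'w measure" where
  "past M P S k =
     vimage_algebra (space M) (\<lambda>\<omega>. \<lambda>i\<in>{1..<k}. S i \<omega>) (Pi\<^sub>M {1..<k} P)"

(* S k is drawn according to P k, independently of S 1, ..., S (k - 1). *)
definition independent_draws ::
  "'w measure \<Rightarrow> (nat \<Rightarrow> 's measure) \<Rightarrow> (nat \<Rightarrow> 'w \<Rightarrow> 's) \<Rightarrow> bool" where
  "independent_draws M P S \<longleftrightarrow>
     (\<forall>k\<ge>1. S k \<in> measurable M (P k) \<and> distr M (P k) (S k) = P k \<and>
        prob_space.indep_set M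
          (sets (vimage_algebra (space M) (S k) (P k))) (sets (past M P S k)))"

end

theory Submission
  imports Defs
begin

text \<open>
  Since \<open>f\<close> is strongly convex, \<open>f\<^sup>*\<close> is \<open>1/\<gamma>\<close>-smooth with gradient \<open>x\<close>, and \<open>D(x, xhat) = f xhat +
  f\<^sup>* z - z \<bullet> xhat\<close>, so a step \<open>s = z' - z\<close> changes \<open>D\<close> by at most \<open>s \<bullet> (x - xhat) + |s|\<^sup>2 / (2\<gamma>)\<close>.
  ASDCD minimises this bound over the span of \<open>d\<close> and \<open>\<Delta>\<close>; the invariant \<open>\<Delta> \<bullet> xhat = \<rho>\<close> makes the
  minimiser computable.  Splitting the projection of \<open>x - xhat\<close> orthogonally along \<open>d\<close> and \<open>u\<close> gives the
  decrease \<open>\<gamma>/2 \<cdot> |S\<^sup>T(Ax - b)|\<^sup>4 / |d|\<^sup>2\<close> plus the cosine term.  The former is at least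
  \<open>\<gamma> / (2\<lambda>\<^sub>m\<^sub>a\<^sub>x) \<cdot> |S\<^sup>T(Ax - b)|\<^sup>2\<close>, up to normalisation of \<open>S\<close>, whose conditional
  expectation is a quadratic form in \<open>H\<close> because \<open>S\<close> is independent of the past.  As \<open>D\<close> never increases from its
  deterministic initial value, all quantities involved are bounded, hence integrable.
\<close>

section \<open>Strongly convex functions and their conjugates\<close>

text \<open>A hyperplane separates the point (x0, f x0) from the strict epigraph, which is convex
  and misses it. If (p, q) is its normal and q > 0, then -p/q is a subgradient at x0.\<close>

lemma subdifferential_nonempty:
  fixes f :: "'a::euclidean_space \<Rightarrow> real"
  assumes f: "convex_on UNIV f"
  shows "subdifferential f x0 \<noteq> {}"
proof -
  define E where "E = {p :: 'a \<times> real. f (fst p) < snd p}"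
  have "convex E"
    unfolding convex_alt
  proof (intro ballI allI impI)
    fix p q :: "'a \<times> real" and u :: real
    assume p: "p \<in> E" and q: "q \<in> E" and u: "0 \<le> u \<and> u \<le> 1"
    have "f ((1 - u) *\<^sub>R fst p + u *\<^sub>R fst q) \<le> (1 - u) * f (fst p) + u * f (fst q)"
      using f u by (auto simp: convex_on_def)
    also have "\<dots> < (1 - u) * snd p + u * snd q"
    proof (cases "u = 0")
      case False
      then have "u * f (fst q) < u * snd q" using u q by (simp add: E_def)
      moreover have "(1 - u) * f (fst p) \<le> (1 - u) * snd p"
        using u p by (intro mult_left_mono) (auto simp: E_def)
      ultimately show ?thesis by simp
    qed (use p in \<open>simp add: E_def\<close>)
    finally show "(1 - u) *\<^sub>R p + u *\<^sub>R q \<in> E" by (simp add: E_def)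
  qed
  moreover have "E \<noteq> {}" "{(x0, f x0)} \<inter> E = {}"
    by (auto simp: E_def intro: exI[of _ "f 0 + 1"] intro!: exI[of _ 0] lt_ex gt_ex)
  ultimately obtain a c where a: "a \<noteq> 0" "a \<bullet> (x0, f x0) \<le> c" "\<And>p. p \<in> E \<Longrightarrow> c \<le> a \<bullet> p"
    using separating_hyperplane_sets[of "{(x0, f x0)}" E] by (metis convex_singleton insert_not_empty singletonI)
  obtain p q where pq: "a = (p, q)" by force
  have sep: "p \<bullet> x0 + q * f x0 \<le> p \<bullet> x + q * t" if "f x < t" for x t
    using a(2) a(3)[of "(x, t)"] that by (simp add: pq E_def)
  \<comment> \<open>The epigraph extends upwards, so q is nonnegative. If q were 0, testing the
    separation at \<open>x0 - p\<close> would force p = 0, a vanishing normal.\<close>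
  have q: "q > 0"
  proof -
    have "0 \<le> q" using sep[of x0 "f x0 + 1"] by (simp add: algebra_simps)
    moreover have "q \<noteq> 0"
    proof
      assume "q = 0"
      then have "p \<bullet> p \<le> 0"
        using sep[of "x0 - p" "f (x0 - p) + 1"] by (simp add: inner_diff_right)
      then have "p = 0" using inner_ge_zero[of p] by (simp add: order_antisym)
      with \<open>q = 0\<close> a(1) pq show False by (simp add: zero_prod_def)
    qed
    ultimately show ?thesis by simp
  qed
  \<comment> \<open>The separation speaks only of points strictly above the graph; raising the point
    by e/q and letting e tend to 0 reaches the graph itself.\<close>
  have "p \<bullet> x0 + q * f x0 \<le> p \<bullet> x + q * f x" for x
  proof (rule field_le_epsilon)
    fix e :: real assume "e > 0"
    then show "p \<bullet> x0 + q * f x0 \<le> p \<bullet> x + q * f x + e"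
      using sep[of x "f x + e / q"] q by (simp add: distrib_left)
  qed
  then have "f x0 + (- (1 / q) *\<^sub>R p) \<bullet> (x - x0) \<le> f x" for x
    using q by (simp add: inner_diff_right field_simps)
  then show ?thesis unfolding subdifferential_def by blast
qed

lemma strongly_convex_lower_bound:
  "f y \<ge> f x + z \<bullet> (y - x) + \<gamma> / 2 * (norm (y - x))\<^sup>2"
  if "strongly_convex \<gamma> f" "z \<in> subdifferential f x"
  using that by (auto simp: strongly_convex_def)

text \<open>A minimiser of f y - z \<bullet> y has z as a subgradient. It exists because strong
  convexity at 0 gives quadratic growth, so that a compact ball suffices for the search.\<close>

lemma subdifferential_surj:
  fixes f :: "'a::euclidean_space \<Rightarrow> real"
  assumes \<gamma>: "\<gamma> > 0" and f: "strongly_convex \<gamma> f"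
  shows "\<exists>x. z \<in> subdifferential f x"
proof -
  have cvx: "convex_on UNIV f" using f by (simp add: strongly_convex_def)
  obtain w where w: "w \<in> subdifferential f 0" using subdifferential_nonempty[OF cvx] by blast
  \<comment> \<open>Outside this radius \<gamma>/2 times the squared norm of y exceeds the linear
    term with slope w - z, so the value there is at least the one at 0.\<close>
  define R where "R = 2 * norm (w - z) / \<gamma>"
  have R: "R \<ge> 0" using \<gamma> by (simp add: R_def)
  have "continuous_on (cball 0 R) (\<lambda>x. f x - z \<bullet> x)"
    using continuous_on_subset[OF convex_on_continuous[OF open_UNIV cvx]]
    by (intro continuous_intros) auto
  then obtain x where x: "x \<in> cball 0 R" "\<And>y. y \<in> cball 0 R \<Longrightarrow> f x - z \<bullet> x \<le> f y - z \<bullet> y"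
    using continuous_attains_inf[of "cball 0 R" "\<lambda>x. f x - z \<bullet> x"] R by auto
  have "f x - z \<bullet> x \<le> f y - z \<bullet> y" for y
  proof (cases "norm y \<le> R")
    case False
    have "norm (w - z) * norm y \<le> \<gamma> / 2 * norm y * norm y"
      using False \<gamma> by (intro mult_right_mono) (auto simp: R_def field_simps)
    moreover have "\<bar>(w - z) \<bullet> y\<bar> \<le> norm (w - z) * norm y"
      by (rule Cauchy_Schwarz_ineq2)
    moreover have "f y \<ge> f 0 + w \<bullet> y + \<gamma> / 2 * (norm y)\<^sup>2"
      using strongly_convex_lower_bound[OF f w, of y] by simp
    moreover have "f x - z \<bullet> x \<le> f 0" using x(2)[of 0] R by simp
    ultimately show ?thesis by (simp add: inner_diff_left power2_eq_square)
  qed (use x in auto)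
  then have "z \<in> subdifferential f x"
    by (auto simp: subdifferential_def inner_diff_right algebra_simps)
  then show ?thesis by blast
qed

section \<open>The conjugate: Fenchel equality, smoothness and gradient\<close>

lemma conjugate_eq:
  assumes "z \<in> subdifferential f x"
  shows "conjugate f z = z \<bullet> x - f x"
proof -
  have "z \<bullet> y - f y \<le> z \<bullet> x - f x" for y
    using assms by (auto simp: subdifferential_def inner_diff_right algebra_simps)
  then show ?thesis
    unfolding conjugate_def by (intro cSup_eq_maximum) auto
qed

text \<open>In this form the distance depends on the iterate only through its dual variable z, so a
  dual step can be estimated by the smoothness of the conjugate.\<close>

lemma bregman_conjugate:
  assumes "z \<in> subdifferential f x"
  shows "bregman f z x y = f y + conjugate f z - z \<bullet> y"
  using conjugate_eq[OF assms] by (simp add: bregman_def inner_diff_right)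

text \<open>Sum of the two strong convexity inequalities, one based at each point.\<close>

lemma subdifferential_cocoercive:
  assumes f: "strongly_convex \<gamma> f"
    and x: "z \<in> subdifferential f x" and y: "w \<in> subdifferential f y"
  shows "\<gamma> * (norm (x - y))\<^sup>2 \<le> (z - w) \<bullet> (x - y)"
proof -
  have "z \<bullet> (y - x) = - (z \<bullet> (x - y))" by (simp add: inner_diff_right)
  with strongly_convex_lower_bound[OF f x, of y] strongly_convex_lower_bound[OF f y, of x]
  show ?thesis
    by (simp add: norm_minus_commute[of y x] inner_diff_left)
qed

text \<open>Smoothness dual to strong convexity: the conjugate at w is attained at some y, f y is
  bounded below from x, and the remaining terms in y - x complete a square.\<close>

lemma conjugate_upper_bound:
  fixes f :: "'a::euclidean_space \<Rightarrow> real"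
  assumes \<gamma>: "\<gamma> > 0" and f: "strongly_convex \<gamma> f"
    and x: "z \<in> subdifferential f x"
  shows "conjugate f w \<le> conjugate f z + (w - z) \<bullet> x + (norm (w - z))\<^sup>2 / (2 * \<gamma>)"
proof -
  obtain y where y: "w \<in> subdifferential f y" using subdifferential_surj[OF \<gamma> f] by blast
  have "(norm p)\<^sup>2 / (2 * \<gamma>) + \<gamma> / 2 * (norm q)\<^sup>2 - p \<bullet> q
      = (norm (p - \<gamma> *\<^sub>R q))\<^sup>2 / (2 * \<gamma>)" for p q :: 'a
  proof -
    have "(norm (p - \<gamma> *\<^sub>R q))\<^sup>2 = (norm p)\<^sup>2 - 2 * \<gamma> * (p \<bullet> q) + \<gamma>\<^sup>2 * (norm q)\<^sup>2"
      unfolding power2_norm_eq_inner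
      by (simp add: inner_diff_left inner_diff_right inner_commute[of q p] power2_eq_square algebra_simps)
    then show ?thesis using \<gamma> by (simp add: field_simps power2_eq_square)
  qed
  moreover have "(norm (w - z - \<gamma> *\<^sub>R (y - x)))\<^sup>2 / (2 * \<gamma>) \<ge> 0" using \<gamma> by simp
  ultimately have "(norm (w - z))\<^sup>2 / (2 * \<gamma>) + \<gamma> / 2 * (norm (y - x))\<^sup>2 - (w - z) \<bullet> (y - x) \<ge> 0"
    by metis
  then show ?thesis
    using strongly_convex_lower_bound[OF f x, of y]
    unfolding conjugate_eq[OF x] conjugate_eq[OF y]
    by (simp add: inner_diff)
qed

text \<open>Dual reading of the subgradient relation: x is a subgradient of the conjugate at
  z.\<close>

lemma conjugate_lower_bound:
  fixes f :: "'a::euclidean_space \<Rightarrow> real"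
  assumes \<gamma>: "\<gamma> > 0" and f: "strongly_convex \<gamma> f"
    and x: "z \<in> subdifferential f x"
  shows "conjugate f z + (w - z) \<bullet> x \<le> conjugate f w"
proof -
  obtain y where y: "w \<in> subdifferential f y" using subdifferential_surj[OF \<gamma> f] by blast
  then show ?thesis
    unfolding conjugate_eq[OF x] conjugate_eq[OF y]
    by (auto simp: subdifferential_def inner_diff algebra_simps)
qed

text \<open>The two preceding bounds enclose the conjugate between its affine approximation with
  slope x and the same plus a quadratic error, which is Frechet differentiability.\<close>

lemma gradient_conjugate_eq:
  fixes f :: "'a::euclidean_space \<Rightarrow> real"
  assumes \<gamma>: "\<gamma> > 0" and f: "strongly_convex \<gamma> f"
    and x: "z \<in> subdifferential f x"
  shows "gradient (conjugate f) z = x"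
proof -
  have "(conjugate f has_derivative (\<lambda>h. h \<bullet> x)) (at z)"
    unfolding has_derivative_at_alt
  proof (intro conjI allI impI)
    show "bounded_linear (\<lambda>h. h \<bullet> x)" by (rule bounded_linear_inner_left)
    fix e :: real assume e: "e > 0"
    show "\<exists>d>0. \<forall>y. norm (y - z) < d \<longrightarrow>
        norm (conjugate f y - conjugate f z - (y - z) \<bullet> x) \<le> e * norm (y - z)"
    \<comment> \<open>Within radius 2\<gamma>e the quadratic error, the squared norm over 2\<gamma>,
      is at most e times the norm.\<close>
    proof (intro exI[of _ "2 * \<gamma> * e"] conjI allI impI)
      show "2 * \<gamma> * e > 0" using \<gamma> e by simp
      fix y assume "norm (y - z) < 2 * \<gamma> * e"
      then have "(norm (y - z))\<^sup>2 / (2 * \<gamma>) \<le> e * norm (y - z)"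
        using \<gamma> mult_right_mono[of "norm (y - z)" "2 * \<gamma> * e" "norm (y - z)"]
        by (simp add: power2_eq_square field_simps)
      then show "norm (conjugate f y - conjugate f z - (y - z) \<bullet> x) \<le> e * norm (y - z)"
        using conjugate_upper_bound[OF \<gamma> f x, of y] conjugate_lower_bound[OF \<gamma> f x, of y]
        by simp
    qed
  qed
  then have D: "GDERIV (conjugate f) z :> x" by (simp add: gderiv_def)
  show ?thesis
    unfolding gradient_def
  proof (rule the_equality)
    show "GDERIV (conjugate f) z :> x" by (fact D)
    fix y assume "GDERIV (conjugate f) z :> y"
    with D have "(\<lambda>h. h \<bullet> y) = (\<lambda>h. h \<bullet> x)"
      unfolding gderiv_def by (rule has_derivative_unique[rotated])
    then have "(y - x) \<bullet> y = (y - x) \<bullet> x" by meson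
    then have "(y - x) \<bullet> (y - x) = 0" by (simp add: inner_diff_right)
    then show "y = x" by simp
  qed
qed

lemma gradient_conjugate_subdifferential:
  fixes f :: "'a::euclidean_space \<Rightarrow> real"
  assumes "\<gamma> > 0" "strongly_convex \<gamma> f"
  shows "z \<in> subdifferential f (gradient (conjugate f) z)"
  using subdifferential_surj[OF assms] gradient_conjugate_eq[OF assms] by metis

text \<open>Cocoercivity and Cauchy-Schwarz make the gradient 1/\<gamma>-Lipschitz. Continuity later
  yields measurability of the primal iterates.\<close>

lemma continuous_on_gradient_conjugate:
  fixes f :: "'a::euclidean_space \<Rightarrow> real"
  assumes \<gamma>: "\<gamma> > 0" and f: "strongly_convex \<gamma> f"
  shows "continuous_on UNIV (gradient (conjugate f))"
proof -
  let ?X = "gradient (conjugate f)"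
  have "dist (?X z) (?X w) \<le> 1 / \<gamma> * dist z w" for z w
  proof -
    have "\<gamma> * (norm (?X z - ?X w))\<^sup>2 \<le> (z - w) \<bullet> (?X z - ?X w)"
      by (intro subdifferential_cocoercive[OF f] gradient_conjugate_subdifferential[OF assms])
    also have "\<dots> \<le> norm (z - w) * norm (?X z - ?X w)"
      by (rule norm_cauchy_schwarz)
    finally have "\<gamma> * norm (?X z - ?X w) \<le> norm (z - w)"
      by (cases "?X z = ?X w") (auto simp: power2_eq_square)
    then show ?thesis using \<gamma> by (simp add: dist_norm field_simps)
  qed
  then have "(1 / \<gamma>)-lipschitz_on UNIV ?X" using \<gamma> by (intro lipschitz_onI) auto
  then show ?thesis by (rule lipschitz_on_continuous_on)
qed

text \<open>The smoothness bound for the conjugate, with the linear term -s \<bullet> v of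
  \<open>bregman_conjugate\<close> absorbed into the inner product.\<close>

lemma bregman_descent:
  fixes f :: "'a::euclidean_space \<Rightarrow> real"
  assumes \<gamma>: "\<gamma> > 0" and f: "strongly_convex \<gamma> f"
    and x: "z \<in> subdifferential f x" and y: "z + s \<in> subdifferential f y"
  shows "bregman f (z + s) y v \<le> bregman f z x v + s \<bullet> (x - v) + (norm s)\<^sup>2 / (2 * \<gamma>)"
  using conjugate_upper_bound[OF \<gamma> f x, of "z + s"]
  unfolding bregman_conjugate[OF x] bregman_conjugate[OF y]
  by (simp add: inner_diff inner_add_left)

lemma bregman_lower_bound:
  assumes "strongly_convex \<gamma> f" "z \<in> subdifferential f x"
  shows "\<gamma> / 2 * (norm (x - y))\<^sup>2 \<le> bregman f z x y"
  using strongly_convex_lower_bound[OF assms, of y]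
  by (simp add: bregman_def norm_minus_commute)

section \<open>Extreme eigenvalues of symmetric matrices\<close>

lemma inner_transpose_mult:
  fixes B :: "real^'n^'m"
  shows "(transpose B *v x) \<bullet> y = x \<bullet> (B *v y)"
  by (simp only: transpose_matrix_vector dot_lmul_matrix)

lemma inner_vector_matrix_mult:
  fixes B :: "real^'n^'m"
  shows "x \<bullet> (y v* B) = (B *v x) \<bullet> y"
  by (metis dot_lmul_matrix inner_commute)

lemma symmetric_inner_mult:
  fixes B :: "real^'n^'n"
  assumes "transpose B = B"
  shows "(B *v x) \<bullet> y = x \<bullet> (B *v y)"
  using inner_transpose_mult[of B x y] assms by simp

text \<open>A nonnegative quadratic form that vanishes at \<open>v\<close> has a critical point there.\<close>

lemma psd_kernel:
  fixes B :: "real^'n^'n"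
  assumes sym: "transpose B = B" and psd: "\<And>w. w \<bullet> (B *v w) \<ge> 0" and v: "v \<bullet> (B *v v) = 0"
  shows "B *v v = 0"
proof -
  define w where "w = B *v v"
  have quad: "0 \<le> 2 * t * (w \<bullet> w) + t\<^sup>2 * (w \<bullet> (B *v w))" for t
  proof -
    have "v \<bullet> (B *v w) = w \<bullet> w"
      using symmetric_inner_mult[OF sym, of v w] by (simp add: w_def)
    then show ?thesis
      using psd[of "v + t *\<^sub>R w"] v
      by (simp add: matrix_vector_right_distrib matrix_vector_mult_scaleR inner_add
          w_def[symmetric] power2_eq_square algebra_simps)
  qed
  have "w \<bullet> w \<le> 0"
  proof (cases "w \<bullet> (B *v w) = 0")
    case True
    then show ?thesis using quad[of "-1"] by simp
  next
    case False
    define q where "q = w \<bullet> (B *v w)"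
    have q: "q > 0" using False psd[of w] by (simp add: q_def)
    \<comment> \<open>The parameter t = -(w \<bullet> w)/q minimises the quadratic in t.\<close>
    have "0 \<le> - (w \<bullet> w)\<^sup>2 / q"
      using quad[of "- (w \<bullet> w) / q"] q unfolding q_def[symmetric]
      by (simp add: field_simps power2_eq_square)
    then have "(w \<bullet> w)\<^sup>2 \<le> 0" using q by (simp add: divide_le_0_iff zero_le_divide_iff)
    then show ?thesis by simp
  qed
  then have "w \<bullet> w = 0" using inner_ge_zero[of w] by (rule order_antisym)
  then show ?thesis by (simp add: w_def)
qed

lemma eigenvalue_rayleigh:
  fixes B :: "real^'n^'n"
  assumes "is_eigenvalue B c"
  obtains v where "norm v = 1" "v \<bullet> (B *v v) = c"
proof -
  obtain v where v: "v \<noteq> 0" "B *v v = c *\<^sub>R v" using assms by (auto simp: is_eigenvalue_def)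
  have "norm (sgn v) = 1" using v by (simp add: norm_sgn)
  moreover have "sgn v \<bullet> (B *v sgn v) = c * (sgn v \<bullet> sgn v)"
    using v by (simp add: sgn_div_norm matrix_vector_mult_scaleR)
  ultimately have "sgn v \<bullet> (B *v sgn v) = c"
    by (simp add: dot_square_norm)
  with \<open>norm (sgn v) = 1\<close> show thesis by (rule that)
qed

text \<open>The maximum c of the quadratic form on the unit sphere is attained at some v. This v is
  an eigenvector by \<open>psd_kernel\<close>, and c bounds every eigenvalue, so the
  \<open>GREATEST\<close> in the definition exists.\<close>

lemma lambda_max_is_greatest:
  fixes B :: "real^'n^'n"
  assumes sym: "transpose B = B"
  shows "is_eigenvalue B (lambda_max B)" "w \<bullet> (B *v w) \<le> lambda_max B * (norm w)\<^sup>2"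
proof -
  let ?q = "\<lambda>v. v \<bullet> (B *v v)"
  have "continuous_on (sphere 0 1) ?q"
    by (intro continuous_intros matrix_vector_mult_linear_continuous_on)
  moreover have "axis undefined 1 \<in> sphere (0 :: real^'n) 1" by simp
  ultimately obtain v where v: "norm v = 1" and le: "\<And>w. norm w = 1 \<Longrightarrow> ?q w \<le> ?q v"
    using continuous_attains_sup[of "sphere 0 1" ?q] by auto
  define c where "c = ?q v"
  have bound: "?q w \<le> c * (norm w)\<^sup>2" for w
  proof (cases "w = 0")
    case False
    then have "?q (sgn w) \<le> c" using le by (simp add: c_def norm_sgn)
    moreover have "?q (t *\<^sub>R v) = t\<^sup>2 * ?q v" for t v
      by (simp add: matrix_vector_mult_scaleR power2_eq_square)
    from this[of "norm w" "sgn w"] have "?q w = (norm w)\<^sup>2 * ?q (sgn w)"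
      using False by (simp add: sgn_div_norm)
    ultimately show ?thesis by (simp add: mult.commute[of c] mult_left_mono)
  qed simp
  \<comment> \<open>c I - B is positive semidefinite since c is the maximum, and its form vanishes
    at v.\<close>
  define N where "N = c *\<^sub>R mat 1 - B"
  have N: "N *v w = c *\<^sub>R w - B *v w" for w
    by (simp add: N_def matrix_vector_mult_diff_rdistrib scaleR_matrix_vector_assoc[symmetric])
  have "transpose N = N"
    using sym by (simp add: N_def vec_eq_iff transpose_def mat_def)
  moreover have "w \<bullet> (N *v w) \<ge> 0" for w
    using bound[of w] by (simp add: N inner_diff_right power2_norm_eq_inner)
  moreover have "v \<bullet> (N *v v) = 0"
    using v by (simp add: N inner_diff_right dot_square_norm c_def)
  ultimately have "N *v v = 0" by (rule psd_kernel)
  then have eig: "is_eigenvalue B c"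
    using v unfolding is_eigenvalue_def N by (intro exI[of _ v]) auto
  have "lambda_max B = c"
    unfolding lambda_max_def
  proof (rule Greatest_equality)
    show "is_eigenvalue B c" by (fact eig)
    fix d assume "is_eigenvalue B d"
    then obtain u where "norm u = 1" "?q u = d" by (rule eigenvalue_rayleigh)
    with bound[of u] show "d \<le> c" by simp
  qed
  with eig bound show "is_eigenvalue B (lambda_max B)" "?q w \<le> lambda_max B * (norm w)\<^sup>2"
    by auto
qed

lemma lambda_min_eq_lambda_max:
  fixes B :: "real^'n^'n"
  assumes sym: "transpose B = B"
  shows "lambda_min B = - lambda_max (- B)"
proof -
  have neg: "- B *v v = - (B *v v)" for v
    using matrix_vector_mult_diff_rdistrib[of 0 B v] by simp
  have iff: "is_eigenvalue (- B) (- c) \<longleftrightarrow> is_eigenvalue B c" for c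
    by (simp add: is_eigenvalue_def neg)
  have sym': "transpose (- B) = - B"
    using sym by (simp add: vec_eq_iff transpose_def)
  note max = lambda_max_is_greatest[OF sym']
  show ?thesis
    unfolding lambda_min_def
  proof (rule Least_equality)
    show "is_eigenvalue B (- lambda_max (- B))" using iff[of "- lambda_max (- B)"] max(1) by simp
    fix d assume "is_eigenvalue B d"
    then have "is_eigenvalue (- B) (- d)" by (simp add: iff)
    then obtain u where "norm u = 1" "u \<bullet> (- B *v u) = - d" by (rule eigenvalue_rayleigh)
    with max(2)[of u] show "- lambda_max (- B) \<le> d" by simp
  qed
qed

lemma lambda_min_is_least:
  fixes B :: "real^'n^'n"
  assumes sym: "transpose B = B"
  shows "is_eigenvalue B (lambda_min B)" "lambda_min B * (norm w)\<^sup>2 \<le> w \<bullet> (B *v w)"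
proof -
  have neg: "- B *v v = - (B *v v)" for v
    using matrix_vector_mult_diff_rdistrib[of 0 B v] by simp
  have "transpose (- B) = - B"
    using sym by (simp add: vec_eq_iff transpose_def)
  note max = lambda_max_is_greatest[OF this]
  show "is_eigenvalue B (lambda_min B)"
    using max(1) unfolding lambda_min_eq_lambda_max[OF sym] is_eigenvalue_def neg
    by (simp add: minus_equation_iff[of _ "_ *\<^sub>R _"] eq_commute)
  show "lambda_min B * (norm w)\<^sup>2 \<le> w \<bullet> (B *v w)"
    using max(2)[of w] unfolding lambda_min_eq_lambda_max[OF sym] neg by simp
qed

section \<open>Sampling matrices and a single step\<close>

lemma gram_mult:
  fixes v :: "real^'m"
  shows "gram S *v v = (\<Sum>c\<leftarrow>S. (c \<bullet> v) *\<^sub>R c)"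
proof (induction S)
  case Nil
  have "gram [] = (0 :: real^'m^'m)" by (simp add: gram_def vec_eq_iff)
  then show ?case by simp
next
  case (Cons c S)
  have "gram (c # S) = (\<chi> i j. c $ i * c $ j) + gram S" by (simp add: gram_def vec_eq_iff)
  moreover have "(\<chi> i j. c $ i * c $ j) *v v = (c \<bullet> v) *\<^sub>R c"
    by (simp add: matrix_vector_mult_def vec_eq_iff inner_vec_def sum_distrib_left
        sum_distrib_right ac_simps)
  ultimately show ?case using Cons by (simp add: matrix_vector_mult_add_rdistrib)
qed

lemma inner_gram: "w \<bullet> (gram S *v v) = (\<Sum>c\<leftarrow>S. (c \<bullet> w) * (c \<bullet> v))"
  unfolding gram_mult by (induction S) (simp_all add: inner_add_right inner_commute)

lemma transpose_gram [simp]: "transpose (gram S) = gram S"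
  by (simp add: gram_def transpose_def vec_eq_iff mult.commute)

lemma list_norm_sq: "(list_norm w)\<^sup>2 = (\<Sum>t\<leftarrow>w. t\<^sup>2)"
  unfolding list_norm_def by (intro real_sqrt_pow2 sum_list_nonneg) auto

lemma list_norm_nonneg: "0 \<le> list_norm w"
  unfolding list_norm_def by (intro real_sqrt_ge_zero sum_list_nonneg) auto

lemma list_norm_transpose_mult_vec:
  "(list_norm (transpose_mult_vec S v))\<^sup>2 = v \<bullet> (gram S *v v)"
  unfolding list_norm_sq by (simp add: inner_gram transpose_mult_vec_def o_def power2_eq_square)

lemma gram_psd: "0 \<le> v \<bullet> (gram S *v v)"
  unfolding list_norm_transpose_mult_vec[symmetric] by simp

text \<open>The supremum is a genuine one: coefficients of a vector of norm at most 1 are at most 1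
  in modulus, so the sum of the column norms is an upper bound.\<close>

lemma spectral_norm_upper:
  assumes "length w = length S" "list_norm w \<le> 1"
  shows "norm (mult_vec S w) \<le> spectral_norm S"
  unfolding spectral_norm_def
proof (rule cSup_upper)
  show "norm (mult_vec S w) \<in> {norm (mult_vec S w) |w. length w = length S \<and> list_norm w \<le> 1}"
    using assms by blast
  show "bdd_above {norm (mult_vec S w) |w. length w = length S \<and> list_norm w \<le> 1}"
  proof (rule bdd_aboveI, clarify)
    fix w :: "real list" assume w: "length w = length S" "list_norm w \<le> 1"
    have "\<bar>w ! j\<bar> \<le> 1" if "j < length S" for j
    proof -
      have "(w ! j)\<^sup>2 \<le> (\<Sum>t\<leftarrow>w. t\<^sup>2)"
        using that w by (intro member_le_sum_list) auto
      also have "\<dots> \<le> 1"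
        using w(2) list_norm_nonneg[of w] unfolding list_norm_sq[symmetric] by (simp add: power_le_one)
      finally show ?thesis using abs_square_le_1 by blast
    qed
    then have "norm (mult_vec S w) \<le> (\<Sum>j<length S. 1 * norm (S ! j))"
      unfolding mult_vec_def
      by (intro sum_norm_le) (auto intro: mult_left_le_one_le)
    then show "norm (mult_vec S w) \<le> (\<Sum>j<length S. norm (S ! j))" by simp
  qed
qed

lemma spectral_norm_nonneg: "0 \<le> spectral_norm S"
  using spectral_norm_upper[of "replicate (length S) 0" S]
  by (auto simp: list_norm_def sum_list_replicate intro: order_trans[OF norm_ge_zero])

text \<open>The transpose has no larger operator norm: the normalised vector w along S^T v satisfies
  v \<bullet> (S w) = |S^T v|, and Cauchy-Schwarz applies.\<close>

lemma list_norm_transpose_mult_vec_le: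
  "list_norm (transpose_mult_vec S v) \<le> spectral_norm S * norm v"
proof (cases "list_norm (transpose_mult_vec S v) = 0")
  case False
  define N where "N = list_norm (transpose_mult_vec S v)"
  have N: "N > 0" using False list_norm_nonneg[of "transpose_mult_vec S v"] by (simp add: N_def)
  define w where "w = map (\<lambda>t. t / N) (transpose_mult_vec S v)"
  have len: "length w = length S" by (simp add: w_def transpose_mult_vec_def)
  have "(\<Sum>t\<leftarrow>w. t\<^sup>2) = (\<Sum>t\<leftarrow>transpose_mult_vec S v. t\<^sup>2) / N\<^sup>2"
    by (simp add: w_def o_def power_mult_distrib divide_inverse sum_list_mult_const power_inverse)
  also have "\<dots> = 1" using N unfolding list_norm_sq[symmetric] N_def[symmetric] by simp
  finally have w1: "list_norm w \<le> 1" by (simp add: list_norm_def)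
  have "v \<bullet> mult_vec S w = (\<Sum>j<length S. (S ! j \<bullet> v)\<^sup>2) / N"
    by (simp add: mult_vec_def inner_sum_right w_def transpose_mult_vec_def sum_divide_distrib
        inner_commute power2_eq_square)
  also have "(\<Sum>j<length S. (S ! j \<bullet> v)\<^sup>2) = N\<^sup>2"
    unfolding N_def list_norm_sq
    by (simp add: transpose_mult_vec_def sum_list_sum_nth o_def atLeast0LessThan)
  finally have "N = v \<bullet> mult_vec S w" using N by (simp add: power2_eq_square)
  also have "\<dots> \<le> norm v * norm (mult_vec S w)" by (rule norm_cauchy_schwarz)
  also have "\<dots> \<le> norm v * spectral_norm S"
    by (intro mult_left_mono spectral_norm_upper len w1) simp
  finally show ?thesis by (simp add: N_def mult.commute)
qed (use spectral_norm_nonneg[of S] in simp)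

lemma gram_le_spectral_norm: "v \<bullet> (gram S *v v) \<le> (spectral_norm S)\<^sup>2 * (norm v)\<^sup>2"
  unfolding list_norm_transpose_mult_vec[symmetric] power_mult_distrib[symmetric]
  by (intro power_mono list_norm_transpose_mult_vec_le list_norm_nonneg)

section \<open>Decrease of the Bregman distance in one step\<close>

lemma sketched_res_sq_eq: "sketched_res_sq A b S x = (A *v x - b) \<bullet> (gram S *v (A *v x - b))"
  by (simp add: sketched_res_sq_def list_norm_transpose_mult_vec)

text \<open>A vanishing sketched residual makes the numerator of \<open>L_adap\<close> vanish, so
  both degenerate branches take the value \<open>L_adap\<close>.\<close>

lemma step_alpha_eq:
  "step_alpha \<gamma> A b S x \<Delta> \<rho> =
     (if step_det A b S x \<Delta> = 0 then L_adap \<gamma> A b S x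
      else \<gamma> * ((sketched_res_sq A b S x * (norm \<Delta>)\<^sup>2
                   - (direction A b S x \<bullet> \<Delta>) * (\<Delta> \<bullet> x - \<rho>)) / step_det A b S x \<Delta>))"
proof -
  have "sketched_res_sq A b S x = 0" if "\<not> (\<exists>t\<in>set (transpose_mult_vec S (A *v x - b)). t \<noteq> 0)"
    using that unfolding sketched_res_sq_def list_norm_sq
    by (subst sum_list_nonneg_eq_0_iff) auto
  then show ?thesis by (auto simp: step_alpha_def L_adap_def)
qed

text \<open>The planar computation behind the step sizes, with e in the role of x - xhat. If g is
  nonzero, w is -\<gamma> times the projection of e onto the span of d and \<Delta>, and u is the
  Gram-Schmidt vector orthogonal to d in that span; the two terms on the right are the squared
  components along d and u.\<close>

lemma sq_div_norm_sq_step: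
  fixes d \<Delta> e :: "'a::real_inner" and \<gamma> s t :: real
  defines "g \<equiv> (norm d)\<^sup>2 * (norm \<Delta>)\<^sup>2 - (d \<bullet> \<Delta>)\<^sup>2"
  defines "\<alpha> \<equiv> if g = 0 then \<gamma> * s / (norm d)\<^sup>2
                  else \<gamma> * ((s * (norm \<Delta>)\<^sup>2 - (d \<bullet> \<Delta>) * t) / g)"
  defines "\<beta> \<equiv> if g = 0 then 0
                  else \<gamma> * ((- (norm d)\<^sup>2 * t + (d \<bullet> \<Delta>) * s) / g)"
  defines "u \<equiv> (d \<bullet> \<Delta>) *\<^sub>R d - (norm d)\<^sup>2 *\<^sub>R \<Delta>"
  defines "w \<equiv> - \<alpha> *\<^sub>R d + \<beta> *\<^sub>R \<Delta>"
  assumes \<gamma>: "\<gamma> > 0" and s: "d \<bullet> e = s" and t: "\<Delta> \<bullet> e = t"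
  shows "w \<bullet> e + (norm w)\<^sup>2 / (2 * \<gamma>) =
    - \<gamma> / 2 * (s\<^sup>2 / (norm d)\<^sup>2) - \<gamma> / 2 * (((e - (s / (norm d)\<^sup>2) *\<^sub>R d) \<bullet> u)\<^sup>2 / (norm u)\<^sup>2)"
proof -
  define D E p where "D = (norm d)\<^sup>2" and "E = (norm \<Delta>)\<^sup>2" and "p = d \<bullet> \<Delta>"
  have g: "g = D * E - p\<^sup>2" by (simp add: g_def D_def E_def p_def)
  have inn: "d \<bullet> d = D" "\<Delta> \<bullet> \<Delta> = E" "d \<bullet> \<Delta> = p" "\<Delta> \<bullet> d = p"
    by (simp_all add: D_def E_def p_def power2_norm_eq_inner inner_commute)
  have "u \<bullet> u = D * g"
    unfolding u_def D_def[symmetric] by (simp add: inner_diff inn g power2_eq_square algebra_simps)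
  then have uu: "(norm u)\<^sup>2 = D * g" by (simp add: power2_norm_eq_inner)
  have "d \<bullet> u = 0" by (simp add: u_def D_def[symmetric] inner_diff_right inn)
  moreover have "e \<bullet> u = p * s - D * t"
    using s t by (simp add: u_def D_def[symmetric] inner_diff_right inn inner_commute[of e])
  ultimately have eu: "(e - (s / D) *\<^sub>R d) \<bullet> u = p * s - D * t" by (simp add: inner_diff_left)
  have we: "w \<bullet> e = - \<alpha> * s + \<beta> * t"
    using s t by (simp add: w_def inner_add_left inner_diff_left)
  have "w \<bullet> w = \<alpha>\<^sup>2 * D - 2 * \<alpha> * \<beta> * p + \<beta>\<^sup>2 * E"
    unfolding w_def by (simp add: inner_add inner_diff inn power2_eq_square algebra_simps)
  then have ww: "(norm w)\<^sup>2 = \<alpha> * (\<alpha> * D - \<beta> * p) + \<beta> * (\<beta> * E - \<alpha> * p)"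
    unfolding power2_norm_eq_inner by (simp add: power2_eq_square algebra_simps)
  show ?thesis
  proof (cases "g = 0")
    \<comment> \<open>Here the squared norm D g of u is 0, so division by zero removes the second
      term; the step is along d alone.\<close>
    case True
    have "\<alpha> = \<gamma> * s / D" "\<beta> = 0" using True by (simp_all add: \<alpha>_def \<beta>_def D_def)
    moreover have "- (\<gamma> * s / D) * s + \<gamma> * s / D * (\<gamma> * s / D * D) / (2 * \<gamma>) = - \<gamma> / 2 * (s\<^sup>2 / D)"
      using \<gamma> by (cases "D = 0") (auto simp: power2_eq_square field_simps)
    ultimately show ?thesis
      unfolding we ww uu D_def[symmetric] True by simp
  next
    case False
    have D: "D \<noteq> 0"
    proof
      assume "D = 0"
      then have "d = 0" by (simp add: D_def)
      with False show False by (simp add: g_def)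
    qed
    have \<alpha>: "\<alpha> = \<gamma> * ((s * E - p * t) / g)" and \<beta>: "\<beta> = \<gamma> * ((p * s - D * t) / g)"
      using False by (simp_all add: \<alpha>_def \<beta>_def D_def E_def p_def)
    \<comment> \<open>The normal equations w \<bullet> d = -\<gamma> s and w \<bullet> \<Delta> =
      -\<gamma> t. They give w \<bullet> w = -\<gamma> (w \<bullet> e), so half of w \<bullet> e
      remains.\<close>
    have "\<alpha> * D - \<beta> * p = \<gamma> * (s * (D * E - p\<^sup>2) / g)"
      unfolding \<alpha> \<beta> using False by (simp add: field_simps power2_eq_square)
    then have n1: "\<alpha> * D - \<beta> * p = \<gamma> * s" using False by (simp add: g)
    have "\<beta> * E - \<alpha> * p = - \<gamma> * (t * (D * E - p\<^sup>2) / g)"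
      unfolding \<alpha> \<beta> using False by (simp add: field_simps power2_eq_square)
    then have n2: "\<beta> * E - \<alpha> * p = - \<gamma> * t" using False by (simp add: g)
    have "w \<bullet> e + (norm w)\<^sup>2 / (2 * \<gamma>) = (- \<alpha> * s + \<beta> * t) / 2"
      unfolding we ww n1 n2 using \<gamma> by (simp add: field_simps)
    also have "\<dots> = - \<gamma> / 2 * ((s\<^sup>2 * E - 2 * p * s * t + D * t\<^sup>2) / g)"
      unfolding \<alpha> \<beta> using False by (simp add: field_simps power2_eq_square)
    \<comment> \<open>Orthogonal splitting: multiplied by D, the left numerator equals s^2 g plus
      the square of e \<bullet> u = p s - D t.\<close>
    also have "(s\<^sup>2 * E - 2 * p * s * t + D * t\<^sup>2) / g
        = (s\<^sup>2 * g + (p * s - D * t)\<^sup>2) / (D * g)"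
      using D False by (simp add: divide_simps) (simp add: g power2_eq_square algebra_simps)
    also have "\<dots> = s\<^sup>2 / D + (p * s - D * t)\<^sup>2 / (D * g)"
      using D False by (simp add: add_divide_distrib)
    finally show ?thesis
      unfolding D_def[symmetric] eu uu by (simp add: algebra_simps)
  qed
qed

text \<open>Cauchy-Schwarz places the quotient in the domain of \<open>arccos\<close>. If a or u is
  0, division by zero makes both sides 0.\<close>

lemma cos_arccos_sq_mult_norm_sq:
  "(cos (arccos (a \<bullet> u / (norm a * norm u))))\<^sup>2 * (norm a)\<^sup>2 = (a \<bullet> u)\<^sup>2 / (norm u)\<^sup>2"
proof -
  have "\<bar>a \<bullet> u\<bar> \<le> norm a * norm u" by (rule Cauchy_Schwarz_ineq2)
  then have "\<bar>a \<bullet> u / (norm a * norm u)\<bar> \<le> 1"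
    by (cases "a = 0 \<or> u = 0") (auto simp: divide_le_eq)
  then have "cos (arccos (a \<bullet> u / (norm a * norm u))) = a \<bullet> u / (norm a * norm u)"
    by (rule cos_arccos_abs)
  then show ?thesis
    by (cases "a = 0") (simp_all add: power_divide power_mult_distrib)
qed

text \<open>Moving A across the inner product turns x - xhat into the residual, so this product is
  computable without knowing xhat.\<close>

lemma direction_inner_error:
  assumes "A *v xhat = b"
  shows "direction A b S x \<bullet> (x - xhat) = sketched_res_sq A b S x"
proof -
  have r: "A *v x - b = A *v (x - xhat)" using assms by (simp add: matrix_vector_mult_diff_distrib)
  show ?thesis
    unfolding direction_def sketched_res_sq_eq inner_transpose_mult r by (rule inner_commute)
qed

text \<open>Squared length of the projection of \<open>y_next\<close> - xhat onto the line of
  \<open>u_vec\<close>, and 0 if that vector vanishes: the cosine term of the theorem without the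
  angle.\<close>

definition alignment_gain where
  "alignment_gain \<gamma> A b xhat S x \<Delta> =
     ((y_next \<gamma> A b S x - xhat) \<bullet> u_vec A b S x \<Delta>)\<^sup>2 / (norm (u_vec A b S x \<Delta>))\<^sup>2"

lemma alignment_gain_nonneg: "0 \<le> alignment_gain \<gamma> A b xhat S x \<Delta>"
  by (simp add: alignment_gain_def)

lemma cos_angle_theta:
  "(cos (angle_theta \<gamma> A b xhat S x \<Delta>))\<^sup>2 * (norm (y_next \<gamma> A b S x - xhat))\<^sup>2 =
   alignment_gain \<gamma> A b xhat S x \<Delta>"
  unfolding angle_theta_def alignment_gain_def by (rule cos_arccos_sq_mult_norm_sq)

lemma asdcd_step_decrease:
  fixes f :: "real^'n \<Rightarrow> real" and A :: "real^'n^'m"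
  assumes \<gamma>: "\<gamma> > 0" and f: "strongly_convex \<gamma> f"
    and x: "z \<in> subdifferential f x" and x': "z' \<in> subdifferential f x'"
    and b: "A *v xhat = b" and \<rho>: "\<Delta> \<bullet> xhat = \<rho>"
    and z': "z' = z - step_alpha \<gamma> A b S x \<Delta> \<rho> *\<^sub>R direction A b S x
                  + step_beta \<gamma> A b S x \<Delta> \<rho> *\<^sub>R \<Delta>"
  shows "bregman f z' x' xhat \<le> bregman f z x xhat
    - \<gamma> / 2 * ((sketched_res_sq A b S x)\<^sup>2 / (norm (direction A b S x))\<^sup>2)
    - \<gamma> / 2 * alignment_gain \<gamma> A b xhat S x \<Delta>"
proof -
  define s where "s = - step_alpha \<gamma> A b S x \<Delta> \<rho> *\<^sub>R direction A b S x
    + step_beta \<gamma> A b S x \<Delta> \<rho> *\<^sub>R \<Delta>"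
  have z's: "z' = z + s" by (simp add: z' s_def)
  \<comment> \<open>The factor \<open>L_adap\<close> / \<gamma> is exactly the coefficient that
    removes from x - xhat its component along d.\<close>
  have y: "y_next \<gamma> A b S x - xhat = x - xhat
      - (sketched_res_sq A b S x / (norm (direction A b S x))\<^sup>2) *\<^sub>R direction A b S x"
    using \<gamma> by (simp add: y_next_def L_adap_def)
  have "s \<bullet> (x - xhat) + (norm s)\<^sup>2 / (2 * \<gamma>) =
      - \<gamma> / 2 * ((sketched_res_sq A b S x)\<^sup>2 / (norm (direction A b S x))\<^sup>2)
      - \<gamma> / 2 * alignment_gain \<gamma> A b xhat S x \<Delta>"
    unfolding s_def alignment_gain_def y u_vec_def step_alpha_eq step_beta_def step_det_def L_adap_def
    using \<rho>
    by (intro sq_div_norm_sq_step \<gamma> direction_inner_error b) (simp add: inner_diff_right)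
  with bregman_descent[OF \<gamma> f x x'[unfolded z's], of xhat] show ?thesis
    unfolding z's by linarith
qed

text \<open>Expanding the form of \<open>B = c \<cdot> A\<^sup>T G A\<close> at \<open>e - B e / \<Lambda>\<close>, which is nonnegative, bounds the
  squared norm of \<open>B e\<close> by \<open>\<Lambda> (e \<bullet> B e)\<close>.\<close>

lemma sketched_res_lower_bound:
  fixes A :: "real^'n^'m"
  assumes b: "A *v xhat = b" and c: "c \<ge> 0"
    and \<Lambda>: "lambda_max (c *\<^sub>R (transpose A ** gram S ** A)) \<le> \<Lambda>" "\<Lambda> > 0"
  shows "c * sketched_res_sq A b S x / \<Lambda> \<le> (sketched_res_sq A b S x)\<^sup>2 / (norm (direction A b S x))\<^sup>2"
proof -
  define B where "B = c *\<^sub>R (transpose A ** gram S ** A)"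
  define e where "e = x - xhat"
  define s d where "s = sketched_res_sq A b S x" and "d = direction A b S x"
  have r: "A *v x - b = A *v e" using b by (simp add: e_def matrix_vector_mult_diff_distrib)
  have Bv: "B *v v = c *\<^sub>R (transpose A *v (gram S *v (A *v v)))" for v
    by (simp add: B_def scaleR_matrix_vector_assoc[symmetric] matrix_vector_mul_assoc matrix_mul_assoc)
  have vBv: "v \<bullet> (B *v v) = c * ((A *v v) \<bullet> (gram S *v (A *v v)))" for v
    by (simp add: Bv inner_vector_matrix_mult dot_lmul_matrix inner_commute)
  have sym: "transpose B = B"
    by (simp add: B_def transpose_scalar matrix_transpose_mul matrix_mul_assoc)
  have Be: "B *v e = c *\<^sub>R d" by (simp add: Bv d_def direction_def r)
  have eBe: "e \<bullet> (B *v e) = c * s" by (simp add: vBv s_def sketched_res_sq_eq r)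
  have s0: "s \<ge> 0" by (simp add: s_def sketched_res_sq_def)
  have ed: "d \<bullet> e = s" unfolding d_def e_def s_def by (rule direction_inner_error[OF b])
  define g where "g = e - (1 / \<Lambda>) *\<^sub>R (B *v e)"
  have "0 \<le> g \<bullet> (B *v g)" unfolding vBv using c gram_psd by (intro mult_nonneg_nonneg)
  also have "g \<bullet> (B *v g) = c * s - 2 / \<Lambda> * ((B *v e) \<bullet> (B *v e))
      + (1 / \<Lambda>)\<^sup>2 * ((B *v e) \<bullet> (B *v (B *v e)))"
    using symmetric_inner_mult[OF sym, of e "B *v e"]
    by (simp add: g_def matrix_vector_mult_diff_distrib matrix_vector_mult_scaleR inner_diff
        eBe power2_eq_square algebra_simps)
  also have "\<dots> \<le> c * s - 2 / \<Lambda> * ((B *v e) \<bullet> (B *v e)) + (1 / \<Lambda>)\<^sup>2 * (\<Lambda> * ((B *v e) \<bullet> (B *v e)))"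
  proof -
    have "(B *v e) \<bullet> (B *v (B *v e)) \<le> lambda_max B * (norm (B *v e))\<^sup>2"
      by (rule lambda_max_is_greatest(2)[OF sym])
    also have "\<dots> \<le> \<Lambda> * (norm (B *v e))\<^sup>2" using \<Lambda>(1) by (intro mult_right_mono) (auto simp: B_def)
    finally show ?thesis
      using \<Lambda>(2) by (intro add_left_mono mult_left_mono) (auto simp: power2_norm_eq_inner)
  qed
  also have "\<dots> = c * (s - c * (norm d)\<^sup>2 / \<Lambda>)"
    using \<Lambda>(2) by (simp add: Be dot_square_norm field_simps power2_eq_square)
  finally have ineq: "0 \<le> c * (s - c * (norm d)\<^sup>2 / \<Lambda>)" .
  show ?thesis
  \<comment> \<open>In these cases the left side is 0: d = 0 forces s = 0 through
    \<open>ed\<close>.\<close>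
  proof (cases "c = 0 \<or> d = 0")
    case True
    then show ?thesis using ed c by (auto simp: s_def[symmetric] d_def[symmetric])
  next
    case False
    then have "c > 0" "d \<noteq> 0" using c by auto
    then have "c * (norm d)\<^sup>2 \<le> s * \<Lambda>"
      using ineq \<Lambda>(2) by (simp add: zero_le_mult_iff field_simps)
    then have "s * (c * (norm d)\<^sup>2) \<le> s * (s * \<Lambda>)" using s0 by (rule mult_left_mono)
    then show ?thesis
      using \<Lambda>(2) \<open>d \<noteq> 0\<close> by (simp add: s_def[symmetric] d_def[symmetric] field_simps power2_eq_square)
  qed
qed

section \<open>The sequences generated by ASDCD\<close>

text \<open>One weight for both normalisations, so that \<open>sample_mean\<close> and
  \<open>sample_lambda_max\<close> are the mean and the supremum of the same weighted family. For
  unbounded samples, spectral norm 0 gets weight 0.\<close>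

definition sample_weight :: "'m::finite sampling_matrix set \<Rightarrow> 'm sampling_matrix \<Rightarrow> real" where
  "sample_weight \<Omega> S = (if bounded_samples \<Omega> then 1 else 1 / (spectral_norm S)\<^sup>2)"

lemma sample_weight_nonneg: "0 \<le> sample_weight \<Omega> S"
  by (simp add: sample_weight_def)

lemma sample_mean_eq: "sample_mean P = (\<integral>S. sample_weight (space P) S *\<^sub>R gram S \<partial>P)"
  by (simp add: sample_mean_def sample_weight_def)

lemma sample_lambda_max_eq:
  "sample_lambda_max A P =
    (SUP S\<in>space P. lambda_max (sample_weight (space P) S *\<^sub>R (transpose A ** gram S ** A)))"
  by (simp add: sample_lambda_max_def sample_weight_def)

text \<open>Either normalisation keeps the weighted squared spectral norms uniformly bounded: by C^2
  for samples bounded by C, by 1 after division.\<close>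

lemma sample_weight_spectral_norm:
  obtains K where "\<And>S. S \<in> \<Omega> \<Longrightarrow> sample_weight \<Omega> S * (spectral_norm S)\<^sup>2 \<le> K"
proof (cases "bounded_samples \<Omega>")
  case True
  then obtain C where C: "\<And>S. S \<in> \<Omega> \<Longrightarrow> spectral_norm S \<le> C" by (auto simp: bounded_samples_def)
  show thesis
  proof (rule that)
    fix S assume "S \<in> \<Omega>"
    then have "(spectral_norm S)\<^sup>2 \<le> C\<^sup>2" using C spectral_norm_nonneg by (intro power_mono) auto
    then show "sample_weight \<Omega> S * (spectral_norm S)\<^sup>2 \<le> C\<^sup>2" using True by (simp add: sample_weight_def)
  qed
next
  case False
  show thesis by (rule that[of 1]) (simp add: sample_weight_def False)
qed

section \<open>The supremum of the largest eigenvalues, and the mean matrix\<close>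

context
  fixes A :: "real^'n^'m" and P :: "'m sampling_matrix measure"
begin

private lemma weighted_form:
  "v \<bullet> ((c *\<^sub>R (transpose A ** gram S ** A)) *v v) = c * ((A *v v) \<bullet> (gram S *v (A *v v)))"
proof -
  have "(c *\<^sub>R (transpose A ** gram S ** A)) *v v = c *\<^sub>R (transpose A *v (gram S *v (A *v v)))"
    by (simp only: scaleR_matrix_vector_assoc[symmetric] matrix_vector_mul_assoc matrix_mul_assoc)
  then show ?thesis
    by (simp only: inner_scaleR_right inner_commute[of v] inner_transpose_mult) (simp add: inner_commute)
qed

private lemma lambda_max_form:
  obtains v where "norm v = 1"
    "lambda_max (c *\<^sub>R (transpose A ** gram S ** A)) = c * ((A *v v) \<bullet> (gram S *v (A *v v)))"
proof -
  have "transpose (c *\<^sub>R (transpose A ** gram S ** A)) = c *\<^sub>R (transpose A ** gram S ** A)"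
    by (simp add: transpose_scalar matrix_transpose_mul matrix_mul_assoc)
  from eigenvalue_rayleigh[OF lambda_max_is_greatest(1)[OF this]] that show thesis
    unfolding weighted_form by metis
qed

text \<open>A real supremum dominates its members only if they are bounded above. Each is a Rayleigh
  quotient, at most the weighted squared spectral norm times the square of a norm bound for
  A.\<close>

lemma lambda_max_le_sample_lambda_max:
  assumes "S \<in> space P"
  shows "lambda_max (sample_weight (space P) S *\<^sub>R (transpose A ** gram S ** A)) \<le> sample_lambda_max A P"
  unfolding sample_lambda_max_eq
proof (rule cSUP_upper[OF assms])
  obtain K where K: "\<And>S. S \<in> space P \<Longrightarrow> sample_weight (space P) S * (spectral_norm S)\<^sup>2 \<le> K"
    using sample_weight_spectral_norm by metis
  obtain a where a: "\<And>v. norm (A *v v) \<le> norm v * a"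
    using bounded_linear.bounded[OF matrix_vector_mul_bounded_linear] by metis
  show "bdd_above ((\<lambda>S. lambda_max (sample_weight (space P) S *\<^sub>R (transpose A ** gram S ** A))) ` space P)"
  proof (rule bdd_aboveI2)
    fix S assume S: "S \<in> space P"
    let ?c = "sample_weight (space P) S"
    obtain v where v: "norm v = 1"
      "lambda_max (?c *\<^sub>R (transpose A ** gram S ** A)) = ?c * ((A *v v) \<bullet> (gram S *v (A *v v)))"
      by (rule lambda_max_form)
    note v(2)
    also have "\<dots> \<le> ?c * ((spectral_norm S)\<^sup>2 * (norm (A *v v))\<^sup>2)"
      by (intro mult_left_mono gram_le_spectral_norm sample_weight_nonneg)
    also have "\<dots> = (?c * (spectral_norm S)\<^sup>2) * (norm (A *v v))\<^sup>2" by simp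
    also have "\<dots> \<le> (?c * (spectral_norm S)\<^sup>2) * a\<^sup>2"
      using a[of v] v(1) by (intro mult_left_mono power_mono) (auto simp: sample_weight_nonneg)
    also have "\<dots> \<le> K * a\<^sup>2" using K[OF S] by (intro mult_right_mono) auto
    finally show "lambda_max (?c *\<^sub>R (transpose A ** gram S ** A)) \<le> K * a\<^sup>2" .
  qed
qed

lemma sample_lambda_max_nonneg:
  assumes "space P \<noteq> {}"
  shows "0 \<le> sample_lambda_max A P"
proof -
  obtain S where S: "S \<in> space P" using assms by blast
  let ?c = "sample_weight (space P) S"
  obtain v where v:
    "lambda_max (?c *\<^sub>R (transpose A ** gram S ** A)) = ?c * ((A *v v) \<bullet> (gram S *v (A *v v)))"
    by (rule lambda_max_form)
  then have "0 \<le> lambda_max (?c *\<^sub>R (transpose A ** gram S ** A))"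
    by (simp add: sample_weight_nonneg gram_psd)
  with lambda_max_le_sample_lambda_max[OF S] show ?thesis by simp
qed

end

text \<open>Serves the case of a non-integrable weighted Gram matrix, where
  \<open>sample_mean\<close> is the zero matrix.\<close>

lemma lambda_min_zero: "lambda_min (0 :: real^'n^'n) = 0"
proof -
  have "is_eigenvalue (0 :: real^'n^'n) (lambda_min (0 :: real^'n^'n))"
    by (rule lambda_min_is_least(1)) (simp add: transpose_def vec_eq_iff)
  then show ?thesis by (auto simp: is_eigenvalue_def)
qed

lemma bounded_linear_matrix_form: "bounded_linear (\<lambda>G :: real^'n^'m. w \<bullet> (G *v v))"
proof -
  have "linear (\<lambda>G :: real^'n^'m. w \<bullet> (G *v v))"
    by (auto intro!: linearI simp: matrix_vector_mult_add_rdistrib inner_add_right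
        scaleR_matrix_vector_assoc[symmetric])
  then show ?thesis by (rule linear_conv_bounded_linear[THEN iffD1])
qed

lemma integral_matrix_form:
  fixes G :: "'a \<Rightarrow> real^'n^'m"
  assumes "integrable P G"
  shows "w \<bullet> ((\<integral>S. G S \<partial>P) *v v) = (\<integral>S. w \<bullet> (G S *v v) \<partial>P)"
  using integral_bounded_linear[OF bounded_linear_matrix_form assms] by simp

text \<open>Symmetry and nonnegativity of the weighted Gram forms pass through the integral; the
  least eigenvalue is the value of the form at a unit vector.\<close>

lemma sample_mean_properties:
  assumes int: "integrable P (\<lambda>S. sample_weight (space P) S *\<^sub>R gram S)"
  shows "transpose (sample_mean P) = sample_mean P" "0 \<le> lambda_min (sample_mean P)"
proof -
  let ?H = "sample_mean P"
  have form: "w \<bullet> (?H *v v) = (\<integral>S. sample_weight (space P) S * (w \<bullet> (gram S *v v)) \<partial>P)" for v w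
    unfolding sample_mean_eq integral_matrix_form[OF int]
    by (simp add: scaleR_matrix_vector_assoc[symmetric])
  have "w \<bullet> (transpose ?H *v v) = w \<bullet> (?H *v v)" for v w
  proof -
    have "w \<bullet> (transpose ?H *v v) = v \<bullet> (?H *v w)"
      by (metis inner_commute inner_transpose_mult)
    also have "\<dots> = w \<bullet> (?H *v v)"
      unfolding form inner_gram by (simp add: mult.commute)
    finally show ?thesis .
  qed
  then have "transpose ?H *v v = ?H *v v" for v by (metis vector_eq_rdot inner_commute)
  then show sym: "transpose ?H = ?H" unfolding matrix_eq by blast
  obtain v where "v \<bullet> (?H *v v) = lambda_min ?H"
    using eigenvalue_rayleigh[OF lambda_min_is_least(1)[OF sym]] by metis
  moreover have "0 \<le> v \<bullet> (?H *v v)"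
    unfolding form by (intro Bochner_Integration.integral_nonneg mult_nonneg_nonneg sample_weight_nonneg gram_psd)
  ultimately show "0 \<le> lambda_min ?H" by simp
qed

text \<open>A non-integrable function has Bochner integral 0, and the zero matrix is not positive
  definite.\<close>

lemma positive_definite_integrable_gram:
  assumes "positive_definite (\<integral>T. gram T \<partial>P)"
  shows "integrable P gram"
proof (rule ccontr)
  assume "\<not> integrable P gram"
  then have "(\<integral>T. gram T \<partial>P) = 0" by (rule not_integrable_integral_eq)
  then have "\<not> positive_definite (\<integral>T. gram T \<partial>P)"
    by (auto simp: positive_definite_def intro!: exI[of _ "axis undefined 1"])
  with assms show False by contradiction
qed

section \<open>Measurability of the iterates\<close>

lemma borel_measurable_matrix_vector_mult [measurable (raw)]:
  fixes G :: "'a \<Rightarrow> real^'n^'m"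
  assumes "G \<in> borel_measurable N" "v \<in> borel_measurable N"
  shows "(\<lambda>\<omega>. G \<omega> *v v \<omega>) \<in> borel_measurable N"
  using assms
  by (rule borel_measurable_continuous_Pair)
    (simp add: matrix_vector_mult_def, intro continuous_intros)

text \<open>The algorithm sees a sampling matrix only through its Gram matrix, which positive definiteness
  of the mean forces to be measurable.\<close>

lemma borel_measurable_asdcd_step:
  fixes A :: "real^'n^'m" and X \<Delta> :: "'w \<Rightarrow> real^'n" and S :: "'w \<Rightarrow> 'm sampling_matrix"
  assumes [measurable]: "(\<lambda>\<omega>. gram (S \<omega>)) \<in> borel_measurable N" "X \<in> borel_measurable N"
    "\<Delta> \<in> borel_measurable N"
  shows borel_measurable_sketched_res_sq: "(\<lambda>\<omega>. sketched_res_sq A b (S \<omega>) (X \<omega>)) \<in> borel_measurable N"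
    and borel_measurable_direction: "(\<lambda>\<omega>. direction A b (S \<omega>) (X \<omega>)) \<in> borel_measurable N"
    and borel_measurable_alignment_gain:
      "(\<lambda>\<omega>. alignment_gain \<gamma> A b xhat (S \<omega>) (X \<omega>) (\<Delta> \<omega>)) \<in> borel_measurable N"
    and borel_measurable_step_alpha: "\<rho> \<in> borel_measurable N \<Longrightarrow>
      (\<lambda>\<omega>. step_alpha \<gamma> A b (S \<omega>) (X \<omega>) (\<Delta> \<omega>) (\<rho> \<omega>)) \<in> borel_measurable N"
    and borel_measurable_step_beta: "\<rho> \<in> borel_measurable N \<Longrightarrow>
      (\<lambda>\<omega>. step_beta \<gamma> A b (S \<omega>) (X \<omega>) (\<Delta> \<omega>) (\<rho> \<omega>)) \<in> borel_measurable N"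
proof -
  show [measurable]: "(\<lambda>\<omega>. sketched_res_sq A b (S \<omega>) (X \<omega>)) \<in> borel_measurable N"
    unfolding sketched_res_sq_eq by measurable
  show [measurable]: "(\<lambda>\<omega>. direction A b (S \<omega>) (X \<omega>)) \<in> borel_measurable N"
    unfolding direction_def by measurable
  show "(\<lambda>\<omega>. alignment_gain \<gamma> A b xhat (S \<omega>) (X \<omega>) (\<Delta> \<omega>)) \<in> borel_measurable N"
    unfolding alignment_gain_def y_next_def u_vec_def L_adap_def by measurable
  assume [measurable]: "\<rho> \<in> borel_measurable N"
  show "(\<lambda>\<omega>. step_alpha \<gamma> A b (S \<omega>) (X \<omega>) (\<Delta> \<omega>) (\<rho> \<omega>)) \<in> borel_measurable N"
    unfolding step_alpha_eq step_det_def L_adap_def by measurable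
  show "(\<lambda>\<omega>. step_beta \<gamma> A b (S \<omega>) (X \<omega>) (\<Delta> \<omega>) (\<rho> \<omega>)) \<in> borel_measurable N"
    unfolding step_beta_def step_det_def by measurable
qed

context
  fixes f :: "real^'n \<Rightarrow> real" and A :: "real^'n^'m" and b \<xi>0 :: "real^'m"
    and \<gamma> :: real and z0 :: "real^'n"
  assumes \<gamma>: "\<gamma> > 0" and f: "strongly_convex \<gamma> f"
begin

text \<open>The iterates up to index k use only draws before k. The \<sigma>-algebra N is left open
  to allow both the whole space and the past.\<close>

lemma asdcd_borel_measurable:
  fixes S :: "nat \<Rightarrow> 'w \<Rightarrow> 'm sampling_matrix"
  assumes alg: "\<And>\<omega>. \<omega> \<in> space N \<Longrightarrow> asdcd_sequences \<gamma> A b f \<xi>0 z0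
      (\<lambda>i. S i \<omega>) (\<lambda>i. x i \<omega>) (\<lambda>i. z i \<omega>) (\<lambda>i. \<rho> i \<omega>)"
    and S: "\<And>i. 1 \<le> i \<Longrightarrow> i < k \<Longrightarrow> (\<lambda>\<omega>. gram (S i \<omega>)) \<in> borel_measurable N"
  shows "j \<le> k \<Longrightarrow> z j \<in> borel_measurable N" "j \<le> k \<Longrightarrow> x j \<in> borel_measurable N"
proof -
  have x: "x j \<in> borel_measurable N" if [measurable]: "z j \<in> borel_measurable N" for j
  proof -
    have [measurable]: "gradient (conjugate f) \<in> borel_measurable borel"
      by (rule borel_measurable_continuous_onI[OF continuous_on_gradient_conjugate[OF \<gamma> f]])
    have "(\<lambda>\<omega>. gradient (conjugate f) (z j \<omega>)) \<in> borel_measurable N" by measurable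
    moreover have "x j \<omega> = gradient (conjugate f) (z j \<omega>)" if "\<omega> \<in> space N" for \<omega>
      using alg[OF that] by (simp add: asdcd_sequences_def)
    ultimately show ?thesis by (subst measurable_cong) auto
  qed
  \<comment> \<open>The recursion reaches two indices back, hence complete induction. The claim on
    \<rho> starts at index 1, where the algorithm first fixes it.\<close>
  have *: "z j \<in> borel_measurable N \<and> (1 \<le> j \<longrightarrow> \<rho> j \<in> borel_measurable N)" if "j \<le> k" for j
    using that
  proof (induction j rule: less_induct)
    case (less j)
    consider "j = 0" | "j = 1" | i where "j = i + 1" "i \<ge> 1"
      by (cases j) (auto simp: Suc_le_eq)
    then show ?case
    proof cases
      case 1
      have "z 0 \<omega> = z0" if "\<omega> \<in> space N" for \<omega>
        using alg[OF that] by (simp add: asdcd_sequences_def)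
      then have "z 0 \<in> borel_measurable N" by (subst measurable_cong) auto
      with 1 show ?thesis by simp
    next
      case 2
      have e: "z 1 \<omega> = z0 + transpose A *v \<xi>0" "\<rho> 1 \<omega> = \<xi>0 \<bullet> b" if "\<omega> \<in> space N" for \<omega>
        using alg[OF that] by (simp_all add: asdcd_sequences_def)
      have "z 1 \<in> borel_measurable N" by (subst measurable_cong[OF e(1)]) auto
      moreover have "\<rho> 1 \<in> borel_measurable N" by (subst measurable_cong[OF e(2)]) auto
      ultimately
      show ?thesis using 2 by simp
    next
      case 3
      have [measurable]: "z i \<in> borel_measurable N" "\<rho> i \<in> borel_measurable N"
        "z (i - 1) \<in> borel_measurable N"
        using less.IH[of i] less.IH[of "i - 1"] less.prems 3 by auto
      note [measurable] = x[OF this(1)]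
      have [measurable]: "(\<lambda>\<omega>. gram (S i \<omega>)) \<in> borel_measurable N"
        using S 3 less.prems by auto
      have \<Delta> [measurable]: "(\<lambda>\<omega>. z i \<omega> - z (i - 1) \<omega>) \<in> borel_measurable N" by measurable
      let ?\<alpha> = "\<lambda>\<omega>. step_alpha \<gamma> A b (S i \<omega>) (x i \<omega>) (z i \<omega> - z (i - 1) \<omega>) (\<rho> i \<omega>)"
      let ?\<beta> = "\<lambda>\<omega>. step_beta \<gamma> A b (S i \<omega>) (x i \<omega>) (z i \<omega> - z (i - 1) \<omega>) (\<rho> i \<omega>)"
      have m: "?\<alpha> \<in> borel_measurable N" "?\<beta> \<in> borel_measurable N"
        "(\<lambda>\<omega>. direction A b (S i \<omega>) (x i \<omega>)) \<in> borel_measurable N"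
        by (intro borel_measurable_step_alpha borel_measurable_step_beta borel_measurable_direction; measurable)+
      note [measurable] = m
      have e: "z (i + 1) \<omega> = z i \<omega> - ?\<alpha> \<omega> *\<^sub>R direction A b (S i \<omega>) (x i \<omega>)
              + ?\<beta> \<omega> *\<^sub>R (z i \<omega> - z (i - 1) \<omega>)"
        "\<rho> (i + 1) \<omega> = - ?\<alpha> \<omega> * ((gram (S i \<omega>) *v (A *v x i \<omega> - b)) \<bullet> b) + ?\<beta> \<omega> * \<rho> i \<omega>"
        if "\<omega> \<in> space N" for \<omega>
        using alg[OF that] 3 by (auto simp: asdcd_sequences_def Let_def)
      have "z (i + 1) \<in> borel_measurable N" by (subst measurable_cong[OF e(1)]) measurable
      moreover have "\<rho> (i + 1) \<in> borel_measurable N" by (subst measurable_cong[OF e(2)]) measurable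
      ultimately show ?thesis using 3 by simp
    qed
  qed
  then show "j \<le> k \<Longrightarrow> z j \<in> borel_measurable N" by blast
  with x show "j \<le> k \<Longrightarrow> x j \<in> borel_measurable N" by blast
qed

section \<open>Invariants along one sample path\<close>

context
  fixes S :: "nat \<Rightarrow> 'm sampling_matrix" and x z \<rho>
  assumes alg: "asdcd_sequences \<gamma> A b f \<xi>0 z0 S x z \<rho>"
begin

lemma asdcd_subdifferential: "z j \<in> subdifferential f (x j)"
  using alg gradient_conjugate_subdifferential[OF \<gamma> f] by (simp add: asdcd_sequences_def)

lemma asdcd_rec:
  assumes "1 \<le> i"
  defines "\<Delta> \<equiv> z i - z (i - 1)"
  defines "\<alpha> \<equiv> step_alpha \<gamma> A b (S i) (x i) \<Delta> (\<rho> i)" and "\<beta> \<equiv> step_beta \<gamma> A b (S i) (x i) \<Delta> (\<rho> i)"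
  shows "z (i + 1) = z i - \<alpha> *\<^sub>R direction A b (S i) (x i) + \<beta> *\<^sub>R \<Delta>"
    "\<rho> (i + 1) = - \<alpha> * ((gram (S i) *v (A *v x i - b)) \<bullet> b) + \<beta> * \<rho> i"
  using alg assms by (auto simp: asdcd_sequences_def Let_def)

text \<open>Start, directions and momentum terms lie in the subspace Range(A^T); the bound defining
  \<nu> is available only for such subgradients.\<close>

lemma asdcd_range:
  assumes z0: "z0 \<in> range ((*v) (transpose A))"
  shows "z j \<in> range ((*v) (transpose A))"
proof (induction j rule: less_induct)
  case (less j)
  have sub: "subspace (range ((*v) (transpose A)))"
    by (intro linear_subspace_image subspace_UNIV) auto
  consider "j = 0" | "j = 1" | i where "j = i + 1" "i \<ge> 1"
    by (cases j) (auto simp: Suc_le_eq)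
  then show ?case
  proof cases
    case 1
    then show ?thesis using alg z0 by (simp add: asdcd_sequences_def)
  next
    case 2
    then have "z j = z0 + transpose A *v \<xi>0" using alg by (simp add: asdcd_sequences_def)
    then show ?thesis using subspace_add[OF sub z0] by simp
  next
    case 3
    have "z i \<in> range ((*v) (transpose A))" "z (i - 1) \<in> range ((*v) (transpose A))"
      using less.IH 3 by auto
    moreover have "direction A b (S i) (x i) \<in> range ((*v) (transpose A))"
      by (simp only: direction_def rangeI)
    ultimately show ?thesis
      unfolding 3(1) asdcd_rec(1)[OF 3(2)] by (intro subspace_add subspace_diff subspace_scale sub)
  qed
qed

lemma asdcd_bregman_nonneg: "0 \<le> bregman f (z j) (x j) xhat"
proof -
  have "0 \<le> \<gamma> / 2 * (norm (x j - xhat))\<^sup>2" using \<gamma> by simp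
  also have "\<dots> \<le> bregman f (z j) (x j) xhat"
    by (rule bregman_lower_bound[OF f asdcd_subdifferential])
  finally show ?thesis .
qed

context
  fixes xhat :: "real^'n"
  assumes xhat: "A *v xhat = b"
begin

text \<open>The recursion for \<rho> mirrors that for \<Delta>: since A xhat = b, the inner product
  of a direction with xhat involves only b.\<close>

lemma asdcd_inner_solution:
  assumes "1 \<le> i"
  shows "(z i - z (i - 1)) \<bullet> xhat = \<rho> i"
  using assms
proof (induction i rule: nat_induct_at_least)
  case base
  then show ?case
    using alg xhat by (simp add: asdcd_sequences_def dot_lmul_matrix)
next
  case (Suc i)
  have "direction A b (S i) (x i) \<bullet> xhat = (gram (S i) *v (A *v x i - b)) \<bullet> b"
    unfolding direction_def inner_transpose_mult xhat ..
  then show ?case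
    using Suc.IH asdcd_rec[OF Suc.hyps]
    by (simp add: inner_diff_left inner_add_left)
qed

lemma asdcd_decrease:
  assumes "1 \<le> i"
  shows "bregman f (z (i + 1)) (x (i + 1)) xhat \<le> bregman f (z i) (x i) xhat
    - \<gamma> / 2 * ((sketched_res_sq A b (S i) (x i))\<^sup>2 / (norm (direction A b (S i) (x i)))\<^sup>2)
    - \<gamma> / 2 * alignment_gain \<gamma> A b xhat (S i) (x i) (z i - z (i - 1))"
  using \<gamma> f asdcd_subdifferential asdcd_subdifferential xhat asdcd_inner_solution[OF assms]
    asdcd_rec(1)[OF assms]
  by (rule asdcd_step_decrease)

text \<open>Both gains are nonnegative, so the distance never grows. This is the source of all later
  integrability.\<close>

lemma asdcd_bregman_le:
  assumes "1 \<le> i"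
  shows "bregman f (z i) (x i) xhat \<le> bregman f (z 1) (x 1) xhat"
  using assms
proof (induction i rule: nat_induct_at_least)
  case (Suc i)
  have "0 \<le> \<gamma> / 2 * ((sketched_res_sq A b (S i) (x i))\<^sup>2 / (norm (direction A b (S i) (x i)))\<^sup>2)"
    "0 \<le> \<gamma> / 2 * alignment_gain \<gamma> A b xhat (S i) (x i) (z i - z (i - 1))"
    using \<gamma> by (simp_all add: alignment_gain_nonneg)
  then show ?case using asdcd_decrease[OF Suc.hyps] Suc.IH by simp
qed simp

end

end

end

section \<open>Conditional expectations\<close>

text \<open>By the characterisation of conditional expectation it suffices to integrate over B in F,
  where independence of g(X) and the indicator of B factors the integral.\<close>

lemma (in prob_space) real_cond_exp_indep:
  fixes g :: "'b \<Rightarrow> real"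
  assumes sub: "subalgebra M F" and X: "X \<in> measurable M N"
    and indep: "indep_set (sets (vimage_algebra (space M) X N)) (sets F)"
    and g [measurable]: "g \<in> borel_measurable N" and int: "integrable M (\<lambda>\<omega>. g (X \<omega>))"
  shows "AE \<omega> in M. real_cond_exp M F (\<lambda>\<omega>. g (X \<omega>)) \<omega> = (\<integral>\<omega>. g (X \<omega>) \<partial>M)"
proof -
  interpret finite_measure_subalgebra M F by unfold_locales (fact sub)
  let ?V = "vimage_algebra (space M) X N"
  have XV: "X \<in> measurable ?V N"
    using X by (intro measurable_vimage_algebra1) (auto simp: measurable_space)
  have gV: "(\<lambda>\<omega>. g (X \<omega>)) \<in> borel_measurable ?V" using XV by measurable
  show ?thesis
  proof (rule real_cond_exp_charact)
    fix B assume B: "B \<in> sets F"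
    then have BM [measurable]: "B \<in> sets M" using sub by (auto simp: subalgebra_def)
    have ind: "indep_var borel (\<lambda>\<omega>. g (X \<omega>)) borel (indicator B :: 'a \<Rightarrow> real)"
      unfolding indep_var_eq
    proof (intro conjI)
      show "random_variable borel (\<lambda>\<omega>. g (X \<omega>))" using X by measurable
      show "random_variable borel (indicator B :: 'a \<Rightarrow> real)" by measurable
      have "sigma_sets (space M) {(\<lambda>\<omega>. g (X \<omega>)) -` C \<inter> space M |C. C \<in> sets borel} \<subseteq> sets ?V"
      proof (rule sets.sigma_sets_subset')
        show "{(\<lambda>\<omega>. g (X \<omega>)) -` C \<inter> space M |C. C \<in> sets borel} \<subseteq> sets ?V"
          using measurable_sets[OF gV] by auto
        show "space M \<in> sets ?V" using sets.top[of ?V] by simp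
      qed
      moreover have "sigma_sets (space M) {(indicator B :: 'a \<Rightarrow> real) -` C \<inter> space M |C. C \<in> sets borel} \<subseteq> sets F"
      proof (rule sets.sigma_sets_subset')
        have sp: "space F = space M" using sub by (simp add: subalgebra_def)
        have "(indicator B :: 'a \<Rightarrow> real) \<in> borel_measurable F" using B by measurable
        from measurable_sets[OF this]
        show "{(indicator B :: 'a \<Rightarrow> real) -` C \<inter> space M |C. C \<in> sets borel} \<subseteq> sets F"
          by (auto simp: sp)
        show "space M \<in> sets F" using sets.top[of F] sp by simp
      qed
      ultimately show "indep_set
          (sigma_sets (space M) {(\<lambda>\<omega>. g (X \<omega>)) -` C \<inter> space M |C. C \<in> sets borel})
          (sigma_sets (space M) {(indicator B :: 'a \<Rightarrow> real) -` C \<inter> space M |C. C \<in> sets borel})"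
        unfolding indep_set_def
        by (intro indep_sets_mono_sets[OF indep[unfolded indep_set_def]]) (auto split: bool.split)
    qed
    have "integrable M (indicator B :: 'a \<Rightarrow> real)"
      by (intro integrable_const_bound[of _ 1]) (auto simp: indicator_def)
    from indep_var_lebesgue_integral[OF ind int this]
    show "set_lebesgue_integral M B (\<lambda>\<omega>. g (X \<omega>))
        = set_lebesgue_integral M B (\<lambda>_. \<integral>\<omega>. g (X \<omega>) \<partial>M)"
      by (simp add: set_lebesgue_integral_def mult.commute)
  qed (use int in simp_all)
qed

text \<open>Freezing the F-measurable vector r: the form is expanded into entries, the factors r_i
  r_j are pulled out, and each independent entry of G is replaced by its mean.\<close>

lemma (in prob_space) real_cond_exp_quadratic_form:
  fixes G :: "'b \<Rightarrow> real^'m^'m" and r :: "'a \<Rightarrow> real^'m"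
  assumes sub: "subalgebra M F" and X: "X \<in> measurable M N"
    and indep: "indep_set (sets (vimage_algebra (space M) X N)) (sets F)"
    and G: "integrable N G" and distr: "distr M N X = N"
    and r: "r \<in> borel_measurable F" and bound: "\<And>\<omega>. \<omega> \<in> space M \<Longrightarrow> norm (r \<omega>) \<le> K"
  shows "integrable M (\<lambda>\<omega>. r \<omega> \<bullet> (G (X \<omega>) *v r \<omega>))"
    and "AE \<omega> in M. real_cond_exp M F (\<lambda>\<omega>. r \<omega> \<bullet> (G (X \<omega>) *v r \<omega>)) \<omega>
           = r \<omega> \<bullet> ((\<integral>T. G T \<partial>N) *v r \<omega>)"
proof -
  interpret finite_measure_subalgebra M F by unfold_locales (fact sub)
  have comp: "bounded_linear (\<lambda>B :: real^'m^'m. B $ i $ j)" for i j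
    by (rule bounded_linear_compose[OF bounded_linear_vec_nth bounded_linear_vec_nth])
  have Gm [measurable]: "(\<lambda>T. G T $ i $ j) \<in> borel_measurable N" for i j
    using integrable_bounded_linear[OF comp G] by auto
  have Gint: "integrable M (\<lambda>\<omega>. G (X \<omega>) $ i $ j)" for i j
    using integrable_distr[OF X] integrable_bounded_linear[OF comp G] unfolding distr by blast
  have mean: "(\<integral>\<omega>. G (X \<omega>) $ i $ j \<partial>M) = (\<integral>T. G T \<partial>N) $ i $ j" for i j
    using integral_distr[OF X Gm] integral_bounded_linear[OF comp G] unfolding distr by simp
  have rF [measurable]: "(\<lambda>\<omega>. r \<omega> $ i) \<in> borel_measurable F" for i
    using r by (rule measurable_compose)
      (intro borel_measurable_continuous_onI continuous_intros)
  have rM [measurable]: "(\<lambda>\<omega>. r \<omega> $ i) \<in> borel_measurable M" for i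
    by (rule measurable_from_subalg[OF sub rF])
  \<comment> \<open>Each entry is dominated by K^2 times the integrable entry of G.\<close>
  have int: "integrable M (\<lambda>\<omega>. (r \<omega> $ i * r \<omega> $ j) * G (X \<omega>) $ i $ j)" for i j
  proof (rule Bochner_Integration.integrable_bound)
    show "integrable M (\<lambda>\<omega>. K\<^sup>2 * G (X \<omega>) $ i $ j)" using Gint by simp
    show "(\<lambda>\<omega>. (r \<omega> $ i * r \<omega> $ j) * G (X \<omega>) $ i $ j) \<in> borel_measurable M"
      using Gint[of i j] by measurable
    show "AE \<omega> in M. norm ((r \<omega> $ i * r \<omega> $ j) * G (X \<omega>) $ i $ j) \<le> norm (K\<^sup>2 * G (X \<omega>) $ i $ j)"
    proof (rule AE_I2)
      fix \<omega> assume "\<omega> \<in> space M"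
      then have "\<bar>r \<omega> $ l\<bar> \<le> K" for l
        using bound component_le_norm_cart[of "r \<omega>" l] by (meson order_trans)
      then have "\<bar>r \<omega> $ i\<bar> * \<bar>r \<omega> $ j\<bar> \<le> K * K"
        by (intro mult_mono) (auto intro: order_trans[OF abs_ge_zero])
      then show "norm ((r \<omega> $ i * r \<omega> $ j) * G (X \<omega>) $ i $ j) \<le> norm (K\<^sup>2 * G (X \<omega>) $ i $ j)"
        by (auto simp: abs_mult power2_eq_square intro!: mult_right_mono)
    qed
  qed
  have expand: "v \<bullet> (B *v v) = (\<Sum>i\<in>UNIV. \<Sum>j\<in>UNIV. (v $ i * v $ j) * B $ i $ j)"
    for v :: "real^'m" and B :: "real^'m^'m"
    by (simp add: inner_vec_def matrix_vector_mult_def sum_distrib_left ac_simps)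
  show "integrable M (\<lambda>\<omega>. r \<omega> \<bullet> (G (X \<omega>) *v r \<omega>))"
    unfolding expand using int by (intro Bochner_Integration.integrable_sum)
  have entry: "AE \<omega> in M. real_cond_exp M F (\<lambda>\<omega>. (r \<omega> $ i * r \<omega> $ j) * G (X \<omega>) $ i $ j) \<omega>
      = (r \<omega> $ i * r \<omega> $ j) * (\<integral>T. G T \<partial>N) $ i $ j" for i j
  proof -
    have "AE \<omega> in M. real_cond_exp M F (\<lambda>\<omega>. (r \<omega> $ i * r \<omega> $ j) * G (X \<omega>) $ i $ j) \<omega>
      = (r \<omega> $ i * r \<omega> $ j) * real_cond_exp M F (\<lambda>\<omega>. G (X \<omega>) $ i $ j) \<omega>"
      by (intro real_cond_exp_mult int) (use Gint[of i j] in measurable)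
    moreover have "AE \<omega> in M. real_cond_exp M F (\<lambda>\<omega>. G (X \<omega>) $ i $ j) \<omega> = (\<integral>T. G T \<partial>N) $ i $ j"
      unfolding mean[symmetric] by (rule real_cond_exp_indep[OF sub X indep Gm Gint])
    ultimately show ?thesis by eventually_elim simp
  qed
  have "AE \<omega> in M. real_cond_exp M F (\<lambda>\<omega>. r \<omega> \<bullet> (G (X \<omega>) *v r \<omega>)) \<omega> =
      (\<Sum>i\<in>UNIV. real_cond_exp M F (\<lambda>\<omega>. \<Sum>j\<in>UNIV. (r \<omega> $ i * r \<omega> $ j) * G (X \<omega>) $ i $ j) \<omega>)"
    unfolding expand using int by (intro real_cond_exp_sum Bochner_Integration.integrable_sum)
  moreover have "AE \<omega> in M. \<forall>i. real_cond_exp M F (\<lambda>\<omega>. \<Sum>j\<in>UNIV. (r \<omega> $ i * r \<omega> $ j) * G (X \<omega>) $ i $ j) \<omega>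
      = (\<Sum>j\<in>UNIV. real_cond_exp M F (\<lambda>\<omega>. (r \<omega> $ i * r \<omega> $ j) * G (X \<omega>) $ i $ j) \<omega>)"
    unfolding AE_all_countable using int by (intro allI real_cond_exp_sum)
  moreover have "AE \<omega> in M. \<forall>i j. real_cond_exp M F (\<lambda>\<omega>. (r \<omega> $ i * r \<omega> $ j) * G (X \<omega>) $ i $ j) \<omega>
      = (r \<omega> $ i * r \<omega> $ j) * (\<integral>T. G T \<partial>N) $ i $ j"
    unfolding AE_all_countable using entry by blast
  ultimately show "AE \<omega> in M. real_cond_exp M F (\<lambda>\<omega>. r \<omega> \<bullet> (G (X \<omega>) *v r \<omega>)) \<omega>
           = r \<omega> \<bullet> ((\<integral>T. G T \<partial>N) *v r \<omega>)"
    by eventually_elim (simp add: expand)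
qed

text \<open>Conditional expectation is monotone and linear, and fixes D, which is
  F-measurable.\<close>

lemma (in sigma_finite_subalgebra) real_cond_exp_drift:
  assumes int: "integrable M D'" "integrable M W" "integrable M D" "integrable M V"
    and D: "D \<in> borel_measurable F"
    and drift: "\<And>\<omega>. \<omega> \<in> space M \<Longrightarrow> D' \<omega> + a * W \<omega> \<le> D \<omega> - V \<omega>"
  shows "AE \<omega> in M. real_cond_exp M F D' \<omega> \<le> D \<omega> - real_cond_exp M F V \<omega> - a * real_cond_exp M F W \<omega>"
proof -
  have "AE \<omega> in M. real_cond_exp M F (\<lambda>\<omega>. D' \<omega> + a * W \<omega>) \<omega> \<le> real_cond_exp M F (\<lambda>\<omega>. D \<omega> - V \<omega>) \<omega>"
    using int drift by (intro real_cond_exp_mono AE_I2) auto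
  moreover have "AE \<omega> in M. real_cond_exp M F (\<lambda>\<omega>. D' \<omega> + a * W \<omega>) \<omega>
      = real_cond_exp M F D' \<omega> + real_cond_exp M F (\<lambda>\<omega>. a * W \<omega>) \<omega>"
    using int by (intro real_cond_exp_add) auto
  moreover have "AE \<omega> in M. real_cond_exp M F (\<lambda>\<omega>. a * W \<omega>) \<omega> = a * real_cond_exp M F W \<omega>"
    using int by (intro real_cond_exp_cmult)
  moreover have "AE \<omega> in M. real_cond_exp M F (\<lambda>\<omega>. D \<omega> - V \<omega>) \<omega>
      = real_cond_exp M F D \<omega> - real_cond_exp M F V \<omega>"
    using int by (intro real_cond_exp_diff)
  moreover have "AE \<omega> in M. real_cond_exp M F D \<omega> = D \<omega>"
    using int D by (intro real_cond_exp_F_meas)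
  ultimately show ?thesis by eventually_elim simp
qed

section \<open>The \<sigma>-algebra of past draws\<close>

lemma subalgebra_past:
  assumes "\<And>i. 1 \<le> i \<Longrightarrow> S i \<in> measurable M (P i)"
  shows "subalgebra M (past M P S k)"
proof -
  have "(\<lambda>\<omega>. \<lambda>i\<in>{1..<k}. S i \<omega>) \<in> measurable M (Pi\<^sub>M {1..<k} P)"
    using assms by (intro measurable_restrict) auto
  then show ?thesis
    unfolding subalgebra_def past_def measurable_iff_sets by simp
qed

lemma measurable_past:
  assumes S: "\<And>i. 1 \<le> i \<Longrightarrow> S i \<in> measurable M (P i)" and j: "1 \<le> j" "j < k"
  shows "S j \<in> measurable (past M P S k) (P j)"
proof -
  let ?r = "\<lambda>\<omega>. \<lambda>i\<in>{1..<k}. S i \<omega>"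
  have "?r \<in> measurable M (Pi\<^sub>M {1..<k} P)"
    using S by (intro measurable_restrict) auto
  then have "?r \<in> measurable (past M P S k) (Pi\<^sub>M {1..<k} P)"
    unfolding past_def by (intro measurable_vimage_algebra1) (auto dest: measurable_space)
  from measurable_compose[OF this measurable_component_singleton[of j]]
  show ?thesis using j by simp
qed

theorem theorem4p3:
  fixes A :: "real^'n^'m" and b \<xi>0 :: "real^'m"
    and f :: "real^'n \<Rightarrow> real" and xhat z0 :: "real^'n"
    and \<gamma> \<nu> :: real
    and M :: "'w measure"
    and P :: "nat \<Rightarrow> 'm sampling_matrix measure"
    and S :: "nat \<Rightarrow> 'w \<Rightarrow> 'm sampling_matrix"
    and x z :: "nat \<Rightarrow> 'w \<Rightarrow> real^'n" and \<rho> :: "nat \<Rightarrow> 'w \<Rightarrow> real"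
    and k :: nat
  assumes consistent: "\<exists>v. A *v v = b"
    and gamma: "\<gamma> > 0" and convex: "strongly_convex \<gamma> f"
    and admissible: "strongly_admissible TYPE('m) f"
    and solution: "is_arg_min f (\<lambda>v. A *v v = b) xhat"
    and nu: "\<nu> > 0"
      "\<forall>v. \<forall>w \<in> subdifferential f v \<inter> range (\<lambda>y. transpose A *v y).
         bregman f w v xhat \<le> 1 / \<nu> * (norm (A *v (v - xhat)))\<^sup>2"
    and sampling: "\<forall>i\<ge>1. prob_space (P i)"
    and pos_def: "\<forall>i\<ge>1. positive_definite (\<integral>T. gram T \<partial>P i)"
    and prob: "prob_space M"
    and draws: "independent_draws M P S"
    and init: "z0 \<in> range (\<lambda>y. transpose A *v y)"
    and algorithm: "\<forall>\<omega>\<in>space M. asdcd_sequences \<gamma> A b f \<xi>0 z0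
         (\<lambda>i. S i \<omega>) (\<lambda>i. x i \<omega>) (\<lambda>i. z i \<omega>) (\<lambda>i. \<rho> i \<omega>)"
    and k: "k \<ge> 1"
  shows "AE \<omega> in M.
    real_cond_exp M (past M P S k) (\<lambda>\<omega>. bregman f (z (k + 1) \<omega>) (x (k + 1) \<omega>) xhat) \<omega>
    \<le> (1 - \<gamma> * \<nu> * lambda_min (sample_mean (P k)) / (2 * sample_lambda_max A (P k)))
         * bregman f (z k \<omega>) (x k \<omega>) xhat
       - \<gamma> / 2 * real_cond_exp M (past M P S k)
           (\<lambda>\<omega>. (cos (angle_theta \<gamma> A b xhat (S k \<omega>) (x k \<omega>) (z k \<omega> - z (k - 1) \<omega>)))\<^sup>2
                * (norm (y_next \<gamma> A b (S k \<omega>) (x k \<omega>) - xhat))\<^sup>2) \<omega>"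
proof -
  interpret prob_space M by (fact prob)
  define F where "F = past M P S k"
  define D where "D j \<omega> = bregman f (z j \<omega>) (x j \<omega>) xhat" for j \<omega>
  define W where "W \<omega> = alignment_gain \<gamma> A b xhat (S k \<omega>) (x k \<omega>) (z k \<omega> - z (k - 1) \<omega>)" for \<omega>
  define \<Lambda> H where "\<Lambda> = sample_lambda_max A (P k)" and "H = sample_mean (P k)"
  define c where "c T = sample_weight (space (P k)) T" for T
  define r where "r \<omega> = A *v x k \<omega> - b" for \<omega>
  have xhat: "A *v xhat = b" using solution by (simp add: is_arg_min_def)
  have alg: "asdcd_sequences \<gamma> A b f \<xi>0 z0 (\<lambda>i. S i \<omega>) (\<lambda>i. x i \<omega>) (\<lambda>i. z i \<omega>) (\<lambda>i. \<rho> i \<omega>)"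
    if "\<omega> \<in> space M" for \<omega> using algorithm that by blast
  have S: "S i \<in> measurable M (P i)" "distr M (P i) (S i) = P i"
    "indep_set (sets (vimage_algebra (space M) (S i) (P i))) (sets (past M P S i))" if "1 \<le> i" for i
    using draws that by (auto simp: independent_draws_def)
  have sub: "subalgebra M F" unfolding F_def by (rule subalgebra_past[OF S(1)])
  then have spF: "space F = space M" by (simp add: subalgebra_def)
  interpret finite_measure_subalgebra M F by unfold_locales (fact sub)
  have gram: "gram \<in> borel_measurable (P i)" if "1 \<le> i" for i
    by (intro borel_measurable_integrable positive_definite_integrable_gram pos_def[rule_format] that)
  have gramM [measurable]: "(\<lambda>\<omega>. gram (S i \<omega>)) \<in> borel_measurable M" if "1 \<le> i" for i
    using S(1)[OF that] gram[OF that] by (rule measurable_compose)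
  have gramF: "(\<lambda>\<omega>. gram (S i \<omega>)) \<in> borel_measurable F" if "1 \<le> i" "i < k" for i
    unfolding F_def using measurable_past[OF S(1) that] gram[OF that(1)] by (rule measurable_compose)
  note meas = asdcd_borel_measurable[OF gamma convex, where S = S and z = z and x = x and \<rho> = \<rho>]
  have zM [measurable]: "z j \<in> borel_measurable M" and xM [measurable]: "x j \<in> borel_measurable M" for j
    by (rule meas[where N = M and k = j, OF alg gramM order.refl]; assumption)+
  \<comment> \<open>The current iterate depends only on the draws before k, so E_k treats it as
    known.\<close>
  have zF [measurable]: "z k \<in> borel_measurable F" and xF [measurable]: "x k \<in> borel_measurable F"
    by (rule meas[where N = F and k = k, OF alg[folded spF] gramF order.refl]; assumption)+
  have [measurable]: "f \<in> borel_measurable borel"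
    using convex by (intro borel_measurable_continuous_onI convex_on_continuous)
      (auto simp: strongly_convex_def)
  have DM [measurable]: "D j \<in> borel_measurable M" for j
    unfolding D_def bregman_def by measurable
  have DF [measurable]: "D k \<in> borel_measurable F"
    unfolding D_def bregman_def by measurable
  have WM [measurable]: "W \<in> borel_measurable M"
    unfolding W_def using k by (intro borel_measurable_alignment_gain gramM) measurable
  have rF [measurable]: "r \<in> borel_measurable F" unfolding r_def by measurable

  \<comment> \<open>The value at index 1 precedes every draw and is therefore a deterministic bound
    for all later distances.\<close>
  define D1 where "D1 = bregman f (z0 + transpose A *v \<xi>0)
      (gradient (conjugate f) (z0 + transpose A *v \<xi>0)) xhat"
  have D1: "D j \<omega> \<le> D1" if "1 \<le> j" "\<omega> \<in> space M" for j \<omega>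
  proof -
    have "D j \<omega> \<le> D 1 \<omega>"
      unfolding D_def by (rule asdcd_bregman_le[OF gamma convex alg[OF that(2)] xhat that(1)])
    also have "D 1 \<omega> = D1"
      using alg[OF that(2)] by (simp add: asdcd_sequences_def D_def D1_def)
    finally show ?thesis .
  qed
  have D0: "0 \<le> D j \<omega>" if "\<omega> \<in> space M" for j \<omega>
    unfolding D_def by (rule asdcd_bregman_nonneg[OF gamma convex alg[OF that]])
  have W0: "0 \<le> W \<omega>" for \<omega> by (simp add: W_def alignment_gain_nonneg)
  have decrease: "D (k + 1) \<omega> + \<gamma> / 2 * W \<omega> \<le> D k \<omega>
      - \<gamma> / 2 * ((sketched_res_sq A b (S k \<omega>) (x k \<omega>))\<^sup>2 / (norm (direction A b (S k \<omega>) (x k \<omega>)))\<^sup>2)"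
    if "\<omega> \<in> space M" for \<omega>
    using asdcd_decrease[OF gamma convex alg[OF that] xhat k] by (simp add: D_def W_def)
  have decrease': "D (k + 1) \<omega> + \<gamma> / 2 * W \<omega> \<le> D k \<omega>" if "\<omega> \<in> space M" for \<omega>
  proof -
    have "0 \<le> \<gamma> / 2 * ((sketched_res_sq A b (S k \<omega>) (x k \<omega>))\<^sup>2 / (norm (direction A b (S k \<omega>) (x k \<omega>)))\<^sup>2)"
      using gamma by simp
    with decrease[OF that] show ?thesis by linarith
  qed
  have intD: "integrable M (D j)" if "1 \<le> j" for j
    using D0 D1 that by (intro integrable_const_bound[of _ D1] AE_I2 DM) auto
  have intW: "integrable M W"
  \<comment> \<open>Since the next distance is nonnegative, \<gamma>/2 times the gain cannot exceed
    the current distance.\<close>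
  proof (intro integrable_const_bound[of _ "2 * D1 / \<gamma>"] AE_I2 WM)
    fix \<omega> assume \<omega>: "\<omega> \<in> space M"
    have "\<gamma> / 2 * W \<omega> \<le> D1"
      using decrease'[OF \<omega>] D0[OF \<omega>, of "k + 1"] D1[OF k \<omega>] by linarith
    then show "norm (W \<omega>) \<le> 2 * D1 / \<gamma>" using gamma W0[of \<omega>] by (simp add: field_simps)
  qed

  \<comment> \<open>V is an integrable part of the guaranteed decrease whose conditional expectation
    already yields the contraction rate.\<close>
  obtain V where V: "integrable M V"
    "\<And>\<omega>. \<omega> \<in> space M \<Longrightarrow> D (k + 1) \<omega> + \<gamma> / 2 * W \<omega> \<le> D k \<omega> - V \<omega>"
    "AE \<omega> in M. \<gamma> * \<nu> * lambda_min H / (2 * \<Lambda>) * D k \<omega> \<le> real_cond_exp M F V \<omega>"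
  proof (cases "\<Lambda> = 0 \<or> \<not> integrable (P k) (\<lambda>T. c T *\<^sub>R gram T)")
    case True
    \<comment> \<open>Here the rate is trivial: division by \<open>0\<close> yields \<open>0\<close>, and so does the integral of a
      non-integrable function.\<close>
    then have "\<Lambda> = 0 \<or> lambda_min H = 0"
      by (auto simp: H_def sample_mean_eq c_def not_integrable_integral_eq lambda_min_zero)
    moreover have "AE \<omega> in M. 0 \<le> real_cond_exp M F (\<lambda>_. 0) \<omega>"
      by (intro real_cond_exp_pos) auto
    ultimately show thesis
      using decrease' by (intro that[of "\<lambda>_. 0"]) auto
  next
    case False
    then have G: "integrable (P k) (\<lambda>T. c T *\<^sub>R gram T)" by simp
    interpret Pk: prob_space "P k" using sampling k by blast
    have \<Lambda>: "\<Lambda> > 0"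
      using False sample_lambda_max_nonneg[of "P k" A] Pk.not_empty by (simp add: \<Lambda>_def)
    have symH: "transpose H = H" and minH: "0 \<le> lambda_min H"
      using sample_mean_properties G by (simp_all add: H_def c_def)
    have res: "r \<omega> = A *v (x k \<omega> - xhat)" for \<omega>
      by (simp add: r_def xhat matrix_vector_mult_diff_distrib)
    obtain a where a: "a > 0" "\<And>v. norm (A *v v) \<le> norm v * a"
      using bounded_linear.pos_bounded[OF matrix_vector_mul_bounded_linear] by metis
    \<comment> \<open>Strong convexity bounds the error by the Bregman distance, hence the residual
      by a constant, as \<open>real_cond_exp_quadratic_form\<close> requires.\<close>
    have rbound: "norm (r \<omega>) \<le> sqrt (2 * D1 / \<gamma>) * a" if \<omega>: "\<omega> \<in> space M" for \<omega>
    proof -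
      have "\<gamma> / 2 * (norm (x k \<omega> - xhat))\<^sup>2 \<le> D k \<omega>"
        unfolding D_def
        by (rule bregman_lower_bound[OF convex asdcd_subdifferential[OF gamma convex alg[OF \<omega>]]])
      also have "\<dots> \<le> D1" by (rule D1[OF k \<omega>])
      finally have "(norm (x k \<omega> - xhat))\<^sup>2 \<le> 2 * D1 / \<gamma>" using gamma by (simp add: field_simps)
      then have "norm (x k \<omega> - xhat) \<le> sqrt (2 * D1 / \<gamma>)" by (rule real_le_rsqrt)
      then show ?thesis
        unfolding res using a by (meson mult_right_mono order_trans less_imp_le)
    qed
    define Q where "Q \<omega> = r \<omega> \<bullet> ((c (S k \<omega>) *\<^sub>R gram (S k \<omega>)) *v r \<omega>)" for \<omega>
    have Q: "Q \<omega> = c (S k \<omega>) * sketched_res_sq A b (S k \<omega>) (x k \<omega>)" for \<omega>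
      by (simp add: Q_def r_def sketched_res_sq_eq scaleR_matrix_vector_assoc[symmetric])
    note quad = real_cond_exp_quadratic_form[OF sub S(1)[OF k] S(3)[OF k, folded F_def] G S(2)[OF k] rF rbound]
    have intQ: "integrable M Q" unfolding Q_def by (rule quad(1))
    have condQ: "AE \<omega> in M. real_cond_exp M F Q \<omega> = r \<omega> \<bullet> (H *v r \<omega>)"
      using quad(2) unfolding Q_def H_def sample_mean_eq c_def .
    show thesis
    \<comment> \<open>The factor is the \<gamma>/2 of the one-step decrease times the 1/\<Lambda> of
      \<open>sketched_res_lower_bound\<close>.\<close>
    proof (rule that[of "\<lambda>\<omega>. \<gamma> / (2 * \<Lambda>) * Q \<omega>"])
      show "integrable M (\<lambda>\<omega>. \<gamma> / (2 * \<Lambda>) * Q \<omega>)" using intQ by simp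
    next
      fix \<omega> assume \<omega>: "\<omega> \<in> space M"
      have "S k \<omega> \<in> space (P k)" using S(1)[OF k] \<omega> by (rule measurable_space)
      from sketched_res_lower_bound[OF xhat sample_weight_nonneg lambda_max_le_sample_lambda_max[OF this]]
      have "Q \<omega> / \<Lambda> \<le> (sketched_res_sq A b (S k \<omega>) (x k \<omega>))\<^sup>2 / (norm (direction A b (S k \<omega>) (x k \<omega>)))\<^sup>2"
        using \<Lambda> unfolding Q \<Lambda>_def c_def by blast
      from mult_left_mono[OF this, of "\<gamma> / 2"] gamma decrease[OF \<omega>]
      show "D (k + 1) \<omega> + \<gamma> / 2 * W \<omega> \<le> D k \<omega> - \<gamma> / (2 * \<Lambda>) * Q \<omega>" by simp
    next
      have "AE \<omega> in M. real_cond_exp M F (\<lambda>\<omega>. \<gamma> / (2 * \<Lambda>) * Q \<omega>) \<omega>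
          = \<gamma> / (2 * \<Lambda>) * real_cond_exp M F Q \<omega>"
        using intQ by (rule real_cond_exp_cmult)
      moreover have "AE \<omega> in M. \<nu> * lambda_min H * D k \<omega> \<le> r \<omega> \<bullet> (H *v r \<omega>)"
      proof (rule AE_I2)
        fix \<omega> assume \<omega>: "\<omega> \<in> space M"
        \<comment> \<open>The bound defining \<nu> applies because z k is a subgradient at x k and
          lies in Range(A^T).\<close>
        have "D k \<omega> \<le> 1 / \<nu> * (norm (r \<omega>))\<^sup>2"
          unfolding D_def res
          using nu(2) asdcd_subdifferential[OF gamma convex alg[OF \<omega>]]
            asdcd_range[OF gamma convex alg[OF \<omega>] init] by blast
        then have "\<nu> * D k \<omega> \<le> (norm (r \<omega>))\<^sup>2" using nu(1) by (simp add: field_simps)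
        then have "lambda_min H * (\<nu> * D k \<omega>) \<le> lambda_min H * (norm (r \<omega>))\<^sup>2"
          using minH by (rule mult_left_mono)
        also have "\<dots> \<le> r \<omega> \<bullet> (H *v r \<omega>)" by (rule lambda_min_is_least(2)[OF symH])
        finally show "\<nu> * lambda_min H * D k \<omega> \<le> r \<omega> \<bullet> (H *v r \<omega>)" by (simp add: ac_simps)
      qed
      ultimately show "AE \<omega> in M. \<gamma> * \<nu> * lambda_min H / (2 * \<Lambda>) * D k \<omega>
          \<le> real_cond_exp M F (\<lambda>\<omega>. \<gamma> / (2 * \<Lambda>) * Q \<omega>) \<omega>"
        using condQ
      proof eventually_elim
        case (elim \<omega>)
        have "\<gamma> / (2 * \<Lambda>) * (\<nu> * lambda_min H * D k \<omega>) \<le> \<gamma> / (2 * \<Lambda>) * (r \<omega> \<bullet> (H *v r \<omega>))"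
          using elim(2) gamma \<Lambda> by (intro mult_left_mono) auto
        then show ?case using elim by (simp add: ac_simps)
      qed
    qed
  qed
  have "AE \<omega> in M. real_cond_exp M F (D (k + 1)) \<omega>
      \<le> D k \<omega> - real_cond_exp M F V \<omega> - \<gamma> / 2 * real_cond_exp M F W \<omega>"
    using intD intW V(1,2) DF k by (intro real_cond_exp_drift) auto
  with V(3) have "AE \<omega> in M. real_cond_exp M F (D (k + 1)) \<omega>
      \<le> (1 - \<gamma> * \<nu> * lambda_min H / (2 * \<Lambda>)) * D k \<omega> - \<gamma> / 2 * real_cond_exp M F W \<omega>"
    by eventually_elim (simp add: left_diff_distrib)
  then show ?thesis
    unfolding cos_angle_theta F_def H_def \<Lambda>_def D_def W_def .
qed

end
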